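(* Let $\{x_k\}$ be an infinite sequence generated by the SQP-type algorithm described in the context, under Assumption A, with penalty parameters $\{\rho_k\}$. Suppose that $\lim_{k\to\infty}\rho_k=0$ and $\lim_{k\to\infty}v_k=0$, and let $\mathcal K_\rho:=\{k\mid\rho_{k+1}<\rho_k\}$. Then every accumulation point of the subsequence $\{x_k\}_{k\in\mathcal K_\rho}$ is a Fritz-John point of the problem: minimize $f(x)$ subject to $h(x)=0$, $G(x)\preceq0$, at which Robinson's constraint qualification fails.
   Context: Notation. $\mathcal S^m$ is the space of real symmetric $m\times m$ matrices, $\langle A,B\rangle=\mathrm{tr}(AB)$, $\preceq,\prec$ are in the Loewner sense, $\lambda_1(A)$ is the largest eigenvalue of $A$, $[a]_+=\max\{0,a\}$, $e_l=(1,\dots,1)^T\in\mathbb R^l$, $I_m$ is the identity. Data: $f:\mathbb R^n\to\mathbb R$, $h:\mathbb R^n\to\mathbb R^l$, $G:\mathbb R^n\to\mathcal S^m$; $g=\nabla f$; $Dh(x)$ is the Jacobian of $h$; $DG(x)d=\sum_i d_i\,\partial G(x)/\partial x_i$; $DG(x)^*Y=(\langle\partial G(x)/\partial x_1,Y\rangle,\dots,\langle\partial G(x)/\partial x_n,Y\rangle)^T$. Subscript $k$ means evaluation at $x_k$ ($f_k,g_k,h_k,G_k,v_k$). Original problem (P): minimize $f(x)$ subject to $h(x)=0$, $G(x)\preceq0$. A point $x$ is a Fritz-John (FJ) point of (P) if there is $(\rho,\mu,Y)\in\mathbb R\times\mathbb R^l\times\mathcal S^m$, $(\rho,\mu,Y)\ne0$,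 $\rho\ge0$, with $\rho g(x)+Dh(x)^T\mu+DG(x)^*Y=0$, $h(x)=0$, $G(x)\preceq0$, $\langle Y,G(x)\rangle=0$, $Y\succeq0$. A feasible point $x^*$ of (P) satisfies Robinson's constraint qualification iff $Dh(x^* )$ has full row rank and there exists a unit vector $\bar d\in\mathbb R^n$ such that $Dh(x^* )\bar d=0$ and $G(x^* )+DG(x^* )\bar d\prec0$. Constraint violation: $v(x)=\|h(x)\|_1+[\lambda_1(G(x))]_+$. Penalty function: $P^\rho(x)=\rho f(x)+v(x)$. Linearizations at $x_k$: $l_k^v(d)=\|h_k+Dh(x_k)d\|_1+[\lambda_1(G_k+DG(x_k)d)]_+$, $\Delta l_k^v(d)=l_k^v(0)-l_k^v(d)$, $\Delta l_k^\rho(d)=-\rho g_k^Td+\Delta l_k^v(d)$. Algorithm. Constants $\epsilon,\delta,\eta,\gamma\in(0,1)$, start $x_0\in\mathbb R^n$, $\rho_0>0$; positive definite matrices $B_k^{fea},B_k\in\mathcal S^n$ are given at each iteration. Iteration $k$: (1) Solve $\min_{d,r,s,t}\ e_l^T(r+s)+t+\frac12d^TB_k^{fea}d$ s.t. $h_k+Dh(x_k)d=r-s$, $G_k+DG(x_k)d\preceq tI_m$, $r\ge0,s\ge0,t\ge0$ ($r,s\in\mathbb R^l$, $t\in\mathbb R$), giving $(d_k^{fea},r_k,s_k,t_k)$ and Lagrange multipliers $(\bar\mu_{k+1},\bar Y_{k+1})\in\mathbb R^l\times\mathcal S^m$ for the equality and semidefinite constraints (Lagrangian: objective $+\mu^T(h_k+Dh(x_k)d-r+s)+\langle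 Y,G_k+DG(x_k)d-tI_m\rangle-\nu_r^Tr-\nu_s^Ts-\nu_tt$, with $Y\succeq0$ and $\nu_r,\nu_s,\nu_t\ge0$). (2) Solve $\min_d\ \rho_kg_k^Td+\frac12d^TB_kd$ s.t. $h_k+Dh(x_k)d=r_k-s_k$, $G_k+DG(x_k)d\preceq t_kI_m$, giving $d_k$ and Lagrange multipliers $(\hat\mu_{k+1},\hat Y_{k+1})$, which are taken to exist: $\rho_kg_k+B_kd_k+Dh(x_k)^T\hat\mu_{k+1}+DG(x_k)^*\hat Y_{k+1}=0$, $\hat Y_{k+1}\succeq0$, $\langle\hat Y_{k+1},G_k+DG(x_k)d_k-t_kI_m\rangle=0$. (3) If $d_k=0$, stop. (4) If $\rho_k(\|\bar\mu_{k+1}\|_\infty+\mathrm{tr}(\bar Y_{k+1}))>1$ or $\rho_k(\|\hat\mu_{k+1}\|_\infty+\mathrm{tr}(\hat Y_{k+1}))>1$, set $\rho_k'=\min\{\delta\rho_k,(1-\epsilon)/(\|\bar\mu_{k+1}\|_\infty+\mathrm{tr}(\bar Y_{k+1})+\|\hat\mu_{k+1}\|_\infty+\mathrm{tr}(\hat Y_{k+1}))\}$; otherwise $\rho_k'=\rho_k$. If $\Delta l_k^{\rho_k'}(d_k)<\epsilon\Delta l_k^v(d_k)$, set $\rho_{k+1}=\min\{\delta\rho_k',\zeta_k\}$ with $\zeta_k=(1-\epsilon)\Delta l_k^v(d_k)/(g_k^Td_k+\frac12d_k^TB_kd_k)$; otherwise $\rho_{k+1}=\rho_k'$. (5) Let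 $\alpha_k$ be the first $\alpha\in\{1,\gamma,\gamma^2,\dots\}$ with $P^{\rho_{k+1}}(x_k+\alpha d_k)-P^{\rho_{k+1}}(x_k)\le-\eta\alpha\Delta l_k^{\rho_{k+1}}(d_k)$; set $x_{k+1}=x_k+\alpha_kd_k$. (No cap on the number of iterations.) Assumption A. (A1) $f,h,G$ are twice continuously differentiable. (A2) There is a convex compact set $\Omega\subseteq\mathbb R^n$ with $x_k\in\Omega$ for all $k$. (A3) There are constants $0<b_1<b_2$ with $b_1\|d\|^2\le d^TB_k^{fea}d\le b_2\|d\|^2$ and $b_1\|d\|^2\le d^TB_kd\le b_2\|d\|^2$ for all $k$ and $d\in\mathbb R^n$. *)

theory Defs
  imports "HOL-Analysis.Analysis"
begin

section \<open>Symmetric matrices\<close>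

definition sym_mat :: "real^'m^'m \<Rightarrow> bool" where
  "sym_mat A \<longleftrightarrow> transpose A = A"

text \<open>The library orders \<^typ>\<open>real^'m^'m\<close> entrywise, so the Loewner order needs its own notation.\<close>

definition loewner_le :: "real^'m^'m \<Rightarrow> real^'m^'m \<Rightarrow> bool" (infix "\<preceq>" 50) where
  "A \<preceq> B \<longleftrightarrow> sym_mat (B - A) \<and> (\<forall>v. 0 \<le> v \<bullet> ((B - A) *v v))"

definition loewner_less :: "real^'m^'m \<Rightarrow> real^'m^'m \<Rightarrow> bool" (infix "\<prec>" 50) where
  "A \<prec> B \<longleftrightarrow> sym_mat (B - A) \<and> (\<forall>v. v \<noteq> 0 \<longrightarrow> 0 < v \<bullet> ((B - A) *v v))"

definition tr_inner :: "real^'m^'m \<Rightarrow> real^'m^'m \<Rightarrow> real" where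
  "tr_inner A B = trace (A ** B)"

definition lambda_max :: "real^'m^'m \<Rightarrow> real" where
  "lambda_max A = Max {c. \<exists>v. v \<noteq> 0 \<and> A *v v = c *\<^sub>R v}"

definition norm1 :: "real^'l \<Rightarrow> real" where
  "norm1 u = (\<Sum>i\<in>UNIV. \<bar>u $ i\<bar>)"


section \<open>Derivatives of the problem data\<close>

definition twice_cont_diff :: "('a::real_normed_vector \<Rightarrow> 'b::real_normed_vector) \<Rightarrow> bool" where
  "twice_cont_diff F \<longleftrightarrow>
     (\<exists>(F' :: 'a \<Rightarrow> 'a \<Rightarrow>\<^sub>L 'b) (F'' :: 'a \<Rightarrow> 'a \<Rightarrow>\<^sub>L ('a \<Rightarrow>\<^sub>L 'b)).
        (\<forall>x. (F has_derivative blinfun_apply (F' x)) (at x)) \<and>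
        (\<forall>x. (F' has_derivative blinfun_apply (F'' x)) (at x)) \<and>
        continuous_on UNIV F'')"

definition gradient :: "(real^'n \<Rightarrow> real) \<Rightarrow> real^'n \<Rightarrow> real^'n" where
  "gradient f x = (THE g. GDERIV f x :> g)"

abbreviation Dh :: "(real^'n \<Rightarrow> real^'l) \<Rightarrow> real^'n \<Rightarrow> real^'n^'l" where
  "Dh h x \<equiv> jacobian h (at x)"

definition partial_deriv :: "(real^'n \<Rightarrow> real^'m^'m) \<Rightarrow> 'n \<Rightarrow> real^'n \<Rightarrow> real^'m^'m" where
  "partial_deriv G i x = vector_derivative (\<lambda>\<tau>. G (x + \<tau> *\<^sub>R axis i 1)) (at 0)"

definition DG :: "(real^'n \<Rightarrow> real^'m^'m) \<Rightarrow> real^'n \<Rightarrow> real^'n \<Rightarrow> real^'m^'m" where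
  "DG G x d = (\<Sum>i\<in>UNIV. (d $ i) *\<^sub>R partial_deriv G i x)"

definition DG_adj :: "(real^'n \<Rightarrow> real^'m^'m) \<Rightarrow> real^'n \<Rightarrow> real^'m^'m \<Rightarrow> real^'n" where
  "DG_adj G x Y = (\<chi> i. tr_inner (partial_deriv G i x) Y)"


section \<open>The nonlinear semidefinite program\<close>

definition FJ_point ::
  "(real^'n \<Rightarrow> real) \<Rightarrow> (real^'n \<Rightarrow> real^'l) \<Rightarrow> (real^'n \<Rightarrow> real^'m^'m) \<Rightarrow> real^'n \<Rightarrow> bool" where
  "FJ_point f h G x \<longleftrightarrow>
     (\<exists>\<rho> \<mu> Y. (\<rho>, \<mu>, Y) \<noteq> (0, 0, 0) \<and> 0 \<le> \<rho> \<and>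
        \<rho> *\<^sub>R gradient f x + transpose (Dh h x) *v \<mu> + DG_adj G x Y = 0 \<and>
        h x = 0 \<and> G x \<preceq> 0 \<and> tr_inner Y (G x) = 0 \<and> 0 \<preceq> Y)"

definition robinson_CQ ::
  "(real^'n \<Rightarrow> real^'l) \<Rightarrow> (real^'n \<Rightarrow> real^'m^'m) \<Rightarrow> real^'n \<Rightarrow> bool" where
  "robinson_CQ h G x \<longleftrightarrow>
     rank (Dh h x) = CARD('l) \<and>
     (\<exists>d. norm d = 1 \<and> Dh h x *v d = 0 \<and> G x + DG G x d \<prec> 0)"

definition viol :: "(real^'n \<Rightarrow> real^'l) \<Rightarrow> (real^'n \<Rightarrow> real^'m^'m) \<Rightarrow> real^'n \<Rightarrow> real" where
  "viol h G x = norm1 (h x) + max 0 (lambda_max (G x))"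

definition penalty ::
  "(real^'n \<Rightarrow> real) \<Rightarrow> (real^'n \<Rightarrow> real^'l) \<Rightarrow> (real^'n \<Rightarrow> real^'m^'m) \<Rightarrow> real \<Rightarrow> real^'n \<Rightarrow> real" where
  "penalty f h G \<rho> x = \<rho> * f x + viol h G x"

definition lin_viol ::
  "(real^'n \<Rightarrow> real^'l) \<Rightarrow> (real^'n \<Rightarrow> real^'m^'m) \<Rightarrow> real^'n \<Rightarrow> real^'n \<Rightarrow> real" where
  "lin_viol h G x d = norm1 (h x + Dh h x *v d) + max 0 (lambda_max (G x + DG G x d))"

definition dlin_viol ::
  "(real^'n \<Rightarrow> real^'l) \<Rightarrow> (real^'n \<Rightarrow> real^'m^'m) \<Rightarrow> real^'n \<Rightarrow> real^'n \<Rightarrow> real" where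
  "dlin_viol h G x d = lin_viol h G x 0 - lin_viol h G x d"

definition dlin_pen ::
  "(real^'n \<Rightarrow> real) \<Rightarrow> (real^'n \<Rightarrow> real^'l) \<Rightarrow> (real^'n \<Rightarrow> real^'m^'m) \<Rightarrow>
   real \<Rightarrow> real^'n \<Rightarrow> real^'n \<Rightarrow> real" where
  "dlin_pen f h G \<rho> x d = - \<rho> * (gradient f x \<bullet> d) + dlin_viol h G x d"


section \<open>The feasibility subproblem\<close>

definition fea_obj ::
  "real^'n^'n \<Rightarrow> (real^'n) \<times> (real^'l) \<times> (real^'l) \<times> real \<Rightarrow> real" where
  "fea_obj Bf = (\<lambda>(d, r, s, t). vec 1 \<bullet> (r + s) + t + (1/2) * (d \<bullet> (Bf *v d)))"

definition fea_constr ::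
  "(real^'n \<Rightarrow> real^'l) \<Rightarrow> (real^'n \<Rightarrow> real^'m^'m) \<Rightarrow> real^'n \<Rightarrow>
   (real^'n) \<times> (real^'l) \<times> (real^'l) \<times> real \<Rightarrow> bool" where
  "fea_constr h G x = (\<lambda>(d, r, s, t).
     h x + Dh h x *v d = r - s \<and> G x + DG G x d \<preceq> t *\<^sub>R mat 1 \<and> 0 \<le> r \<and> 0 \<le> s \<and> 0 \<le> t)"

definition fea_lagrangian ::
  "(real^'n \<Rightarrow> real^'l) \<Rightarrow> (real^'n \<Rightarrow> real^'m^'m) \<Rightarrow> real^'n \<Rightarrow> real^'n^'n \<Rightarrow>
   real^'l \<Rightarrow> real^'m^'m \<Rightarrow> real^'l \<Rightarrow> real^'l \<Rightarrow> real \<Rightarrow>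
   (real^'n) \<times> (real^'l) \<times> (real^'l) \<times> real \<Rightarrow> real" where
  "fea_lagrangian h G x Bf \<mu> Y \<nu>r \<nu>s \<nu>t = (\<lambda>(d, r, s, t).
     fea_obj Bf (d, r, s, t)
     + \<mu> \<bullet> (h x + Dh h x *v d - r + s)
     + tr_inner Y (G x + DG G x d - t *\<^sub>R mat 1)
     - \<nu>r \<bullet> r - \<nu>s \<bullet> s - \<nu>t * t)"

text \<open>Karush-Kuhn-Tucker multipliers; only those of the equality and of the semidefinite
  constraint are passed on to the algorithm.\<close>

definition fea_multipliers ::
  "(real^'n \<Rightarrow> real^'l) \<Rightarrow> (real^'n \<Rightarrow> real^'m^'m) \<Rightarrow> real^'n \<Rightarrow> real^'n^'n \<Rightarrow>
   real^'n \<Rightarrow> real^'l \<Rightarrow> real^'l \<Rightarrow> real \<Rightarrow> real^'l \<Rightarrow> real^'m^'m \<Rightarrow> bool" where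
  "fea_multipliers h G x Bf d r s t \<mu> Y \<longleftrightarrow>
     0 \<preceq> Y \<and> tr_inner Y (G x + DG G x d - t *\<^sub>R mat 1) = 0 \<and>
     (\<exists>\<nu>r \<nu>s \<nu>t. 0 \<le> \<nu>r \<and> 0 \<le> \<nu>s \<and> 0 \<le> \<nu>t \<and>
        \<nu>r \<bullet> r = 0 \<and> \<nu>s \<bullet> s = 0 \<and> \<nu>t * t = 0 \<and>
        (fea_lagrangian h G x Bf \<mu> Y \<nu>r \<nu>s \<nu>t has_derivative (\<lambda>_. 0)) (at (d, r, s, t)))"


section \<open>The quadratic semidefinite subproblem\<close>

definition qp_obj :: "(real^'n \<Rightarrow> real) \<Rightarrow> real \<Rightarrow> real^'n \<Rightarrow> real^'n^'n \<Rightarrow> real^'n \<Rightarrow> real" where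
  "qp_obj f \<rho> x B d = \<rho> * (gradient f x \<bullet> d) + (1/2) * (d \<bullet> (B *v d))"

definition qp_constr ::
  "(real^'n \<Rightarrow> real^'l) \<Rightarrow> (real^'n \<Rightarrow> real^'m^'m) \<Rightarrow> real^'n \<Rightarrow>
   real^'l \<Rightarrow> real^'l \<Rightarrow> real \<Rightarrow> real^'n \<Rightarrow> bool" where
  "qp_constr h G x r s t d \<longleftrightarrow>
     h x + Dh h x *v d = r - s \<and> G x + DG G x d \<preceq> t *\<^sub>R mat 1"

definition qp_multipliers ::
  "(real^'n \<Rightarrow> real) \<Rightarrow> (real^'n \<Rightarrow> real^'l) \<Rightarrow> (real^'n \<Rightarrow> real^'m^'m) \<Rightarrow>
   real \<Rightarrow> real^'n \<Rightarrow> real^'n^'n \<Rightarrow> real \<Rightarrow> real^'n \<Rightarrow> real^'l \<Rightarrow> real^'m^'m \<Rightarrow> bool" where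
  "qp_multipliers f h G \<rho> x B t d \<mu> Y \<longleftrightarrow>
     \<rho> *\<^sub>R gradient f x + B *v d + transpose (Dh h x) *v \<mu> + DG_adj G x Y = 0 \<and>
     0 \<preceq> Y \<and> tr_inner Y (G x + DG G x d - t *\<^sub>R mat 1) = 0"


section \<open>Penalty parameter update and line search\<close>

definition mult_size :: "real^'l \<Rightarrow> real^'m^'m \<Rightarrow> real" where
  "mult_size \<mu> Y = infnorm \<mu> + trace Y"

text \<open>The arguments \<open>a\<close> and \<open>b\<close> are the sizes of the multipliers of the two subproblems.\<close>

definition rho_trial :: "real \<Rightarrow> real \<Rightarrow> real \<Rightarrow> real \<Rightarrow> real \<Rightarrow> real" where
  "rho_trial \<epsilon> \<delta> \<rho> a b =
     (if \<rho> * a > 1 \<or> \<rho> * b > 1 then min (\<delta> * \<rho>) ((1 - \<epsilon>) / (a + b)) else \<rho>)"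

definition rho_next ::
  "(real^'n \<Rightarrow> real) \<Rightarrow> (real^'n \<Rightarrow> real^'l) \<Rightarrow> (real^'n \<Rightarrow> real^'m^'m) \<Rightarrow>
   real \<Rightarrow> real \<Rightarrow> real^'n \<Rightarrow> real^'n^'n \<Rightarrow> real^'n \<Rightarrow> real \<Rightarrow> real" where
  "rho_next f h G \<epsilon> \<delta> x B d \<rho>' =
     (if dlin_pen f h G \<rho>' x d < \<epsilon> * dlin_viol h G x d
      then min (\<delta> * \<rho>')
             ((1 - \<epsilon>) * dlin_viol h G x d / (gradient f x \<bullet> d + (1/2) * (d \<bullet> (B *v d))))
      else \<rho>')"

definition armijo ::
  "(real^'n \<Rightarrow> real) \<Rightarrow> (real^'n \<Rightarrow> real^'l) \<Rightarrow> (real^'n \<Rightarrow> real^'m^'m) \<Rightarrow>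
   real \<Rightarrow> real \<Rightarrow> real^'n \<Rightarrow> real^'n \<Rightarrow> real \<Rightarrow> bool" where
  "armijo f h G \<eta> \<rho> x d \<alpha> \<longleftrightarrow>
     penalty f h G \<rho> (x + \<alpha> *\<^sub>R d) - penalty f h G \<rho> x \<le> - \<eta> * \<alpha> * dlin_pen f h G \<rho> x d"


section \<open>Infinite runs of the algorithm\<close>

text \<open>The index of the multiplier sequences is the iteration in which they are computed:
  \<open>\<mu>b k\<close>, \<open>Yb k\<close> are the multipliers usually written with subscript \<open>k + 1\<close>, and likewise for
  \<open>\<mu>h k\<close>, \<open>Yh k\<close>. Since the run is infinite, the stopping test \<open>d k = 0\<close> always fails.\<close>

definition sqp_run ::
  "(real^'n \<Rightarrow> real) \<Rightarrow> (real^'n \<Rightarrow> real^'l) \<Rightarrow> (real^'n \<Rightarrow> real^'m^'m) \<Rightarrow>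
   real \<Rightarrow> real \<Rightarrow> real \<Rightarrow> real \<Rightarrow>
   (nat \<Rightarrow> real^'n) \<Rightarrow> (nat \<Rightarrow> real) \<Rightarrow> (nat \<Rightarrow> real^'n^'n) \<Rightarrow> (nat \<Rightarrow> real^'n^'n) \<Rightarrow>
   (nat \<Rightarrow> real^'n) \<Rightarrow> (nat \<Rightarrow> real^'l) \<Rightarrow> (nat \<Rightarrow> real^'l) \<Rightarrow> (nat \<Rightarrow> real) \<Rightarrow>
   (nat \<Rightarrow> real^'l) \<Rightarrow> (nat \<Rightarrow> real^'m^'m) \<Rightarrow>
   (nat \<Rightarrow> real^'n) \<Rightarrow> (nat \<Rightarrow> real^'l) \<Rightarrow> (nat \<Rightarrow> real^'m^'m) \<Rightarrow> (nat \<Rightarrow> real) \<Rightarrow> bool" where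
  "sqp_run f h G \<epsilon> \<delta> \<eta> \<gamma> x \<rho> Bf B df r s t \<mu>b Yb d \<mu>h Yh \<alpha> \<longleftrightarrow>
     0 < \<rho> 0 \<and>
     (\<forall>k. 0 \<prec> Bf k \<and> 0 \<prec> B k \<and>
        is_arg_min (fea_obj (Bf k)) (fea_constr h G (x k)) (df k, r k, s k, t k) \<and>
        fea_multipliers h G (x k) (Bf k) (df k) (r k) (s k) (t k) (\<mu>b k) (Yb k) \<and>
        is_arg_min (qp_obj f (\<rho> k) (x k) (B k)) (qp_constr h G (x k) (r k) (s k) (t k)) (d k) \<and>
        qp_multipliers f h G (\<rho> k) (x k) (B k) (t k) (d k) (\<mu>h k) (Yh k) \<and>
        d k \<noteq> 0 \<and>
        \<rho> (Suc k) = rho_next f h G \<epsilon> \<delta> (x k) (B k) (d k)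
          (rho_trial \<epsilon> \<delta> (\<rho> k) (mult_size (\<mu>b k) (Yb k)) (mult_size (\<mu>h k) (Yh k))) \<and>
        (\<exists>j. \<alpha> k = \<gamma> ^ j \<and> armijo f h G \<eta> (\<rho> (Suc k)) (x k) (d k) (\<gamma> ^ j) \<and>
           (\<forall>i<j. \<not> armijo f h G \<eta> (\<rho> (Suc k)) (x k) (d k) (\<gamma> ^ i))) \<and>
        x (Suc k) = x k + \<alpha> k *\<^sub>R d k)"

definition subseq_accum_point :: "(nat \<Rightarrow> 'a::topological_space) \<Rightarrow> nat set \<Rightarrow> 'a \<Rightarrow> bool" where
  "subseq_accum_point x K a \<longleftrightarrow>
     (\<exists>\<phi>. strict_mono \<phi> \<and> range \<phi> \<subseteq> K \<and> (x \<circ> \<phi>) \<longlonglongrightarrow> a)"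

end

theory Submission
  imports Defs
begin

text \<open>
  Call a pair \<open>(\<mu>, Y) \<noteq> (0, 0)\<close> with \<open>Y \<succeq> 0\<close>, \<open>Dh(x)\<^sup>T \<mu> + DG(x)\<^sup>* Y = 0\<close> and \<open>\<langle>Y, G(x)\<rangle> = 0\<close> singular at
  \<open>x\<close>. At a feasible point it is a Fritz-John multiplier with \<open>\<rho> = 0\<close>, and it excludes Robinson's
  condition: pairing it with a direction \<open>d\<close> such that \<open>Dh(x) d = 0\<close> and \<open>G(x) + DG(x) d \<prec> 0\<close> forces
  \<open>Y = 0\<close>, and full row rank then forces \<open>\<mu> = 0\<close>. Both claims therefore follow once a singular pair
  is found at the accumulation point, which is feasible because the violation tends to zero.

  Suppose that there is none. Comparing \<open>d = 0\<close> with the solution of the feasibility problem,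
  and that solution with the step \<open>d\<^sub>k\<close>, shows that both directions and the slack \<open>t\<^sub>k\<close> tend to zero
  (\<open>fea_opt_bounds\<close>, \<open>qp_step_bound\<close>). Since also \<open>\<rho>\<^sub>k \<longrightarrow> 0\<close>, the stationarity conditions of
  both subproblems reduce in the limit to the equation for singular pairs. Multipliers that stayed
  away from zero could be normalised and would have a singular limit, so the multipliers of both
  subproblems tend to zero (\<open>asymptotic_multipliers_tendsto_0\<close>).

  Small multipliers of the feasibility problem mean that its slacks vanish, hence that \<open>d\<^sub>k\<close> removes
  the whole linearised violation: \<open>\<Delta>l\<^sup>v(d\<^sub>k) = v\<^sub>k\<close>. Pairing the stationarity condition of the
  second subproblem with \<open>d\<^sub>k\<close> gives \<open>\<rho>\<^sub>k g\<^sub>k\<^sup>T d\<^sub>k \<le> (\<parallel>\<mu>\<parallel>\<^sub>\<infinity> + tr Y) v\<^sub>k\<close>, which is at most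
  \<open>(1 - \<epsilon>) v\<^sub>k\<close> for small multipliers, while the products of \<open>\<rho>\<^sub>k\<close> with the multiplier
  sizes fall below 1. So neither test for reducing \<open>\<rho>\<^sub>k\<close> succeeds
  (\<open>rho_next_eq_if_small_multipliers\<close>), contrary to \<open>\<rho>\<^sub>k\<^sub>+\<^sub>1 < \<rho>\<^sub>k\<close>.
\<close>

section \<open>Positive semidefinite matrices\<close>

lemma psd_iff: "0 \<preceq> A \<longleftrightarrow> sym_mat A \<and> (\<forall>v. 0 \<le> v \<bullet> (A *v v))"
  by (simp add: loewner_le_def)

lemma sym_mat_inner_commute:
  assumes "sym_mat A"
  shows "u \<bullet> (A *v w) = w \<bullet> (A *v u)"
proof -
  have "u \<bullet> (A *v w) = (u v* A) \<bullet> w"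
    by (simp add: dot_lmul_matrix)
  also have "u v* A = A *v u"
    by (metis assms sym_mat_def transpose_matrix_vector)
  finally show ?thesis by (simp add: inner_commute)
qed

lemma sym_mat_add: "sym_mat A \<Longrightarrow> sym_mat B \<Longrightarrow> sym_mat (A + B)"
  and sym_mat_diff: "sym_mat A \<Longrightarrow> sym_mat B \<Longrightarrow> sym_mat (A - B)"
  and sym_mat_scaleR: "sym_mat A \<Longrightarrow> sym_mat (c *\<^sub>R A)"
  and sym_mat_mat: "sym_mat (mat c)"
  by (simp_all add: sym_mat_def transpose_def vec_eq_iff mat_def)

lemma quadratic_form_add_scaleR:
  assumes "sym_mat A"
  shows "(u + \<tau> *\<^sub>R w) \<bullet> (A *v (u + \<tau> *\<^sub>R w))
    = u \<bullet> (A *v u) + 2 * \<tau> * (u \<bullet> (A *v w)) + \<tau>\<^sup>2 * (w \<bullet> (A *v w))"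
  using sym_mat_inner_commute[OF assms, of w u]
  by (simp add: matrix_vector_right_distrib matrix_vector_mult_scaleR inner_add_left inner_add_right
      algebra_simps power2_eq_square)

text \<open>The usual discriminant argument; only the case of a vanishing quadratic form at \<open>w\<close>, where the
  minimising \<open>\<tau>\<close> does not exist, has to be treated apart.\<close>

lemma psd_cauchy_schwarz:
  assumes "0 \<preceq> A"
  shows "(u \<bullet> (A *v w))\<^sup>2 \<le> (u \<bullet> (A *v u)) * (w \<bullet> (A *v w))"
proof -
  define a b c where "a = u \<bullet> (A *v u)" and "b = u \<bullet> (A *v w)" and "c = w \<bullet> (A *v w)"
  have sym: "sym_mat A" and nonneg: "\<And>v. 0 \<le> v \<bullet> (A *v v)"
    using assms by (auto simp: psd_iff)
  have quad: "0 \<le> a + 2 * \<tau> * b + \<tau>\<^sup>2 * c" for \<tau>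
    using nonneg[of "u + \<tau> *\<^sub>R w"] quadratic_form_add_scaleR[OF sym, of u \<tau> w]
    by (simp add: a_def b_def c_def)
  have "0 \<le> c" unfolding c_def by (rule nonneg)
  then consider "c = 0" | "c > 0" by linarith
  then have "b\<^sup>2 \<le> a * c"
  proof cases
    case 1
    have "b = 0"
    proof (rule ccontr)
      assume "b \<noteq> 0"
      \<comment> \<open>At this \<open>\<tau>\<close> the affine function \<open>a + 2 \<tau> b\<close> takes the value \<open>-1\<close>.\<close>
      then show False using quad[of "- (a + 1) / (2 * b)"] 1 by (simp add: field_simps)
    qed
    then show ?thesis using 1 by simp
  next
    case 2
    then show ?thesis using quad[of "- b / c"] by (simp add: field_simps power2_eq_square)
  qed
  then show ?thesis by (simp add: a_def b_def c_def)
qed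

lemma psd_quadratic_form_eq_0_imp:
  assumes "0 \<preceq> A" "u \<bullet> (A *v u) = 0"
  shows "A *v u = 0"
proof -
  have "((A *v u) \<bullet> (A *v u))\<^sup>2 \<le> 0"
    using psd_cauchy_schwarz[OF assms(1), of "A *v u" u] assms(2) by simp
  then show ?thesis by simp
qed

text \<open>A bound on the quadratic form of a positive semidefinite matrix bounds its operator norm: this is
  the Cauchy-Schwarz inequality of the form for \<open>A d\<close> and \<open>d\<close>.\<close>

lemma psd_norm_matrix_vector_le:
  assumes "0 \<preceq> A" "\<And>u. u \<bullet> (A *v u) \<le> b * (norm u)\<^sup>2"
  shows "norm (A *v d) \<le> b * norm d"
proof (cases "A *v d = 0 \<or> d = 0")
  case True
  moreover have "0 \<le> b * (norm d)\<^sup>2"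
    using assms by (metis order_trans psd_iff)
  ultimately show ?thesis
    by (auto simp: zero_le_mult_iff)
next
  case False
  define n where "n = norm (A *v d)"
  have n: "n > 0" and d: "norm d > 0" using False by (auto simp: n_def)
  have nonneg: "0 \<le> v \<bullet> (A *v v)" for v using assms(1) by (simp add: psd_iff)
  have "0 \<le> b * (norm d)\<^sup>2" using nonneg[of d] assms(2)[of d] by linarith
  then have b: "0 \<le> b" using d by (simp add: zero_le_mult_iff)
  have "(n\<^sup>2)\<^sup>2 \<le> ((A *v d) \<bullet> (A *v (A *v d))) * (d \<bullet> (A *v d))"
    using psd_cauchy_schwarz[OF assms(1), of "A *v d" d] by (simp add: n_def power2_norm_eq_inner)
  also have "\<dots> \<le> (b * n\<^sup>2) * (b * (norm d)\<^sup>2)"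
    unfolding n_def by (intro mult_mono assms(2) nonneg) (use b in auto)
  finally have "n\<^sup>2 * n\<^sup>2 \<le> n\<^sup>2 * (b * norm d)\<^sup>2"
    by (simp add: power2_eq_square algebra_simps)
  then have "n\<^sup>2 \<le> (b * norm d)\<^sup>2"
    by (rule mult_left_le_imp_le) (use n in simp)
  then have "n \<le> b * norm d"
    by (rule power2_le_imp_le) (use b in simp)
  then show ?thesis by (simp add: n_def)
qed

lemma tr_inner_commute: "tr_inner A B = tr_inner B A"
  unfolding tr_inner_def by (rule trace_mul_sym)

lemma tr_inner_eq_sum: "tr_inner A B = (\<Sum>i\<in>UNIV. \<Sum>j\<in>UNIV. A $ i $ j * B $ j $ i)"
  by (simp add: tr_inner_def trace_def matrix_matrix_mult_def)

lemma tr_inner_add_right: "tr_inner A (B + C) = tr_inner A B + tr_inner A C"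
  by (simp add: tr_inner_eq_sum sum.distrib distrib_left)

lemma tr_inner_scaleR_right: "tr_inner A (c *\<^sub>R B) = c * tr_inner A B"
  by (simp add: tr_inner_eq_sum sum_distrib_left mult.left_commute)

lemma tr_inner_diff_right: "tr_inner A (B - C) = tr_inner A B - tr_inner A C"
  by (simp add: tr_inner_eq_sum sum_subtractf right_diff_distrib)

lemma tr_inner_add_left: "tr_inner (A + B) C = tr_inner A C + tr_inner B C"
  by (simp add: tr_inner_commute[of _ C] tr_inner_add_right)

lemma tr_inner_scaleR_left: "tr_inner (c *\<^sub>R A) B = c * tr_inner A B"
  by (simp add: tr_inner_commute[of _ B] tr_inner_scaleR_right)

lemma tr_inner_mat_1_right: "tr_inner A (mat 1) = trace A"
  by (simp add: tr_inner_def)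

lemma tr_inner_zero_right: "tr_inner A 0 = 0"
  by (simp add: tr_inner_eq_sum)

lemma tr_inner_sum_right: "tr_inner A (\<Sum>i\<in>S. B i) = (\<Sum>i\<in>S. tr_inner A (B i))"
  by (induction S rule: infinite_finite_induct)
    (simp_all add: tr_inner_add_right tr_inner_zero_right)

definition outer :: "real^'m \<Rightarrow> real^'m^'m" where
  "outer w = (\<chi> i j. w $ i * w $ j)"

lemma sym_mat_outer: "sym_mat (outer w)"
  by (simp add: sym_mat_def outer_def transpose_def vec_eq_iff mult.commute)

lemma outer_vector_mult: "outer w *v u = (w \<bullet> u) *\<^sub>R w"
  by (simp add: outer_def matrix_vector_mult_def vec_eq_iff inner_vec_def sum_distrib_left
      mult.assoc mult.left_commute mult.commute)

lemma tr_inner_outer: "tr_inner (outer w) Z = w \<bullet> (Z *v w)"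
proof -
  have "tr_inner Z (outer w) = (\<Sum>i\<in>UNIV. \<Sum>j\<in>UNIV. w $ i * (Z $ i $ j * w $ j))"
    unfolding tr_inner_eq_sum outer_def by (intro sum.cong refl) simp
  then show ?thesis
    by (simp add: tr_inner_commute[of "outer w"] matrix_vector_mult_def inner_vec_def sum_distrib_left)
qed

text \<open>One elimination step: if \<open>w = Y u \<noteq> 0\<close>, then by the Cauchy-Schwarz inequality subtracting
  \<open>w w\<^sup>T / (u\<^sup>T w)\<close> leaves a positive semidefinite matrix. Its range lies in that of \<open>Y\<close> and is
  orthogonal to \<open>u\<close>, so it misses \<open>w\<close> and the rank drops. Iterating this writes \<open>Y\<close> as a positive
  combination of dyads without the spectral theorem.\<close>

lemma psd_split_rank_one:
  fixes Y :: "real^'m^'m"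
  assumes "0 \<preceq> Y" "Y \<noteq> 0"
  obtains Y' w c where "w \<noteq> 0" "0 < c" "Y = Y' + c *\<^sub>R outer w" "0 \<preceq> Y'"
    "dim (range ((*v) Y')) < dim (range ((*v) Y))"
proof -
  have sym: "sym_mat Y" and nonneg: "\<And>v. 0 \<le> v \<bullet> (Y *v v)"
    using assms(1) by (auto simp: psd_iff)
  obtain u where u: "Y *v u \<noteq> 0"
    using assms(2) by (metis matrix_eq matrix_vector_mult_0)
  define w a Y' where "w = Y *v u" and "a = u \<bullet> w" and "Y' = Y - (1 / a) *\<^sub>R outer w"
  have a: "a > 0"
    using psd_quadratic_form_eq_0_imp[OF assms(1), of u] u nonneg[of u]
    unfolding a_def w_def by linarith
  have Y'_mult: "Y' *v v = Y *v v - ((w \<bullet> v) / a) *\<^sub>R w" for v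
    by (simp add: Y'_def matrix_vector_mult_diff_rdistrib scaleR_matrix_vector_assoc[symmetric]
        outer_vector_mult)
  have symY': "sym_mat Y'"
    unfolding Y'_def by (intro sym_mat_diff sym_mat_scaleR sym sym_mat_outer)
  have "0 \<le> v \<bullet> (Y' *v v)" for v
  proof -
    have "(v \<bullet> w)\<^sup>2 \<le> (v \<bullet> (Y *v v)) * a"
      using psd_cauchy_schwarz[OF assms(1), of v u] by (simp add: a_def w_def)
    then show ?thesis
      using a by (simp add: Y'_mult inner_diff_right inner_commute field_simps power2_eq_square)
  qed
  with symY' have psd: "0 \<preceq> Y'" by (simp add: psd_iff)
  have "Y' *v v = Y *v (v - ((w \<bullet> v) / a) *\<^sub>R u)" for v
    by (simp add: Y'_mult matrix_vector_mult_diff_distrib matrix_vector_mult_scaleR w_def)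
  then have sub: "range ((*v) Y') \<subseteq> range ((*v) Y)" by auto
  have "w \<notin> range ((*v) Y')"
  proof
    assume "w \<in> range ((*v) Y')"
    then obtain v where v: "w = Y' *v v" by auto
    have "Y' *v u = 0" using a by (simp add: Y'_mult a_def inner_commute w_def)
    then have "u \<bullet> (Y' *v v) = 0"
      using sym_mat_inner_commute[OF symY', of u v] by simp
    then show False using a v by (simp add: a_def)
  qed
  then have "range ((*v) Y') \<subset> range ((*v) Y)"
    using sub by (auto simp: w_def)
  then have "dim (range ((*v) Y')) < dim (range ((*v) Y))"
    by (intro dim_psubset)
      (simp add: span_eq_iff[THEN iffD2] subspace_UNIV linear_subspace_image)
  moreover have "Y = Y' + (1 / a) *\<^sub>R outer w" by (simp add: Y'_def)
  moreover have "w \<noteq> 0" "0 < 1 / a" using u a by (simp_all add: w_def)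
  ultimately show thesis using psd that by blast
qed

text \<open>One half of the self-duality of the semidefinite cone, by induction on the rank: each dyad \<open>w w\<^sup>T\<close> split off
  from \<open>Y\<close> contributes \<open>w\<^sup>T Z w \<ge> 0\<close>.\<close>

lemma tr_inner_psd_nonneg:
  assumes "0 \<preceq> Y" "0 \<preceq> Z"
  shows "0 \<le> tr_inner Y Z"
  using assms(1)
proof (induction "dim (range ((*v) Y))" arbitrary: Y rule: less_induct)
  case less
  show ?case
  proof (cases "Y = 0")
    case True
    then show ?thesis by (simp add: tr_inner_commute[of 0] tr_inner_zero_right)
  next
    case False
    obtain Y' w c where s: "0 < c" "Y = Y' + c *\<^sub>R outer w" "0 \<preceq> Y'"
      "dim (range ((*v) Y')) < dim (range ((*v) Y))"
      using psd_split_rank_one[OF less.prems False] by metis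
    have "0 \<le> w \<bullet> (Z *v w)" using assms(2) by (simp add: psd_iff)
    then show ?thesis
      using less.hyps[OF s(4) s(3)] s(1)
      unfolding s(2) by (simp add: tr_inner_add_left tr_inner_scaleR_left tr_inner_outer)
  qed
qed

text \<open>A nonzero \<open>Y\<close> splits off a dyad \<open>w w\<^sup>T\<close>, which already contributes the positive amount
  \<open>w\<^sup>T Z w\<close>.\<close>

lemma tr_inner_psd_pd_pos:
  assumes "0 \<preceq> Y" "Y \<noteq> 0" "loewner_less 0 Z"
  shows "0 < tr_inner Y Z"
proof -
  obtain Y' w c where s: "w \<noteq> 0" "0 < c" "Y = Y' + c *\<^sub>R outer w" "0 \<preceq> Y'"
    using psd_split_rank_one[OF assms(1,2)] by metis
  have pos: "\<And>v. v \<noteq> 0 \<Longrightarrow> 0 < v \<bullet> (Z *v v)" and "sym_mat Z"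
    using assms(3) by (auto simp: loewner_less_def)
  have "0 \<le> v \<bullet> (Z *v v)" for v
    using pos[of v] by (cases "v = 0") auto
  with \<open>sym_mat Z\<close> have "0 \<preceq> Z" by (simp add: psd_iff)
  then show ?thesis
    using tr_inner_psd_nonneg[OF s(4)] pos[OF s(1)] s(2)
    unfolding s(3) by (simp add: tr_inner_add_left tr_inner_scaleR_left tr_inner_outer
        add_nonneg_pos)
qed

lemma psd_trace_nonneg: "0 \<preceq> Y \<Longrightarrow> 0 \<le> trace Y"
  using tr_inner_psd_nonneg[of Y "mat 1"]
  by (simp add: tr_inner_mat_1_right psd_iff sym_mat_mat)

lemma tr_inner_le_trace_mult:
  assumes "0 \<preceq> Y" "A \<preceq> c *\<^sub>R mat 1"
  shows "tr_inner Y A \<le> c * trace Y"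
proof -
  have "0 \<preceq> c *\<^sub>R mat 1 - A" using assms(2) by (simp add: loewner_le_def)
  from tr_inner_psd_nonneg[OF assms(1) this] show ?thesis
    by (simp add: tr_inner_diff_right tr_inner_scaleR_right tr_inner_mat_1_right)
qed


section \<open>The largest eigenvalue\<close>

text \<open>Eigenvectors for distinct eigenvalues are orthogonal, hence independent. Finiteness is what gives
  the \<^const>\<open>Max\<close> in the definition of \<^const>\<open>lambda_max\<close> its meaning.\<close>

lemma finite_eigenvalues_sym:
  fixes A :: "real^'m^'m"
  assumes "sym_mat A"
  shows "finite {c. \<exists>v. v \<noteq> 0 \<and> A *v v = c *\<^sub>R v}"
proof -
  define E where "E = {c. \<exists>v. v \<noteq> 0 \<and> A *v v = c *\<^sub>R v}"
  have "\<forall>c\<in>E. \<exists>v. v \<noteq> 0 \<and> A *v v = c *\<^sub>R v" by (simp add: E_def)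
  from bchoice[OF this] obtain e
    where e: "\<And>c. c \<in> E \<Longrightarrow> e c \<noteq> 0 \<and> A *v e c = c *\<^sub>R e c"
    by blast
  have orth: "e a \<bullet> e b = 0" if "a \<in> E" "b \<in> E" "a \<noteq> b" for a b
    using sym_mat_inner_commute[OF assms, of "e a" "e b"] e[OF that(1)] e[OF that(2)] that(3)
    by (simp add: inner_commute)
  have "inj_on e E"
    by (rule inj_onI) (metis e inner_eq_zero_iff orth)
  moreover have "finite (e ` E)"
  proof -
    have "pairwise orthogonal (e ` E)"
      using orth by (auto simp: pairwise_def orthogonal_def)
    moreover have "0 \<notin> e ` E" using e by auto
    ultimately show ?thesis
      by (metis pairwise_orthogonal_independent independent_imp_finite)
  qed
  ultimately show ?thesis
    unfolding E_def[symmetric] by (rule finite_imageD[rotated])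
qed

text \<open>The maximum \<open>l\<close> of the quadratic form on the unit sphere is an eigenvalue: the form of
  \<open>l I - A\<close> is positive semidefinite and vanishes at the maximiser, which therefore lies in its
  kernel.\<close>

lemma lambda_max_properties:
  fixes A :: "real^'m^'m"
  assumes "sym_mat A"
  shows loewner_le_lambda_max: "A \<preceq> lambda_max A *\<^sub>R mat 1"
    and lambda_max_le: "A \<preceq> c *\<^sub>R mat 1 \<Longrightarrow> lambda_max A \<le> c"
proof -
  define E where "E = {c. \<exists>v. v \<noteq> 0 \<and> A *v v = c *\<^sub>R v}"
  have "compact (sphere (0::real^'m) 1)" "sphere (0::real^'m) 1 \<noteq> {}"
    by (simp_all add: sphere_eq_empty)
  moreover have "continuous_on (sphere 0 1) (\<lambda>v. v \<bullet> (A *v v))"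
    by (intro continuous_intros matrix_vector_mult_linear_continuous_on)
  ultimately obtain u where u: "norm u = 1"
    and max: "\<And>v. norm v = 1 \<Longrightarrow> v \<bullet> (A *v v) \<le> u \<bullet> (A *v u)"
    using continuous_attains_sup[of "sphere 0 1" "\<lambda>v. v \<bullet> (A *v v)"] by auto
  define l where "l = u \<bullet> (A *v u)"
  have l: "v \<bullet> (A *v v) \<le> l * (v \<bullet> v)" for v
  proof (cases "v = 0")
    case False
    then have "(v /\<^sub>R norm v) \<bullet> (A *v (v /\<^sub>R norm v)) \<le> l"
      unfolding l_def by (intro max) simp
    then show ?thesis using False
      by (simp add: matrix_vector_mult_scaleR field_simps flip: power2_norm_eq_inner power2_eq_square)
  qed simp
  have mult: "(c *\<^sub>R mat 1 - A) *v v = c *\<^sub>R v - A *v v" for c v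
    by (simp add: matrix_vector_mult_diff_rdistrib scaleR_matrix_vector_assoc[symmetric])
  have symc: "sym_mat (c *\<^sub>R mat 1 - A)" for c
    by (intro sym_mat_diff sym_mat_scaleR sym_mat_mat assms)
  have le: "A \<preceq> l *\<^sub>R mat 1"
    using l by (simp add: loewner_le_def mult symc inner_diff_right)
  then have "0 \<preceq> l *\<^sub>R mat 1 - A" by (simp add: loewner_le_def)
  moreover have "u \<bullet> ((l *\<^sub>R mat 1 - A) *v u) = 0"
    using u by (simp add: mult inner_diff_right l_def flip: power2_norm_eq_inner)
  ultimately have "(l *\<^sub>R mat 1 - A) *v u = 0" by (rule psd_quadratic_form_eq_0_imp)
  then have "A *v u = l *\<^sub>R u" by (simp add: mult)
  moreover have "u \<noteq> 0" using u by auto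
  ultimately have lE: "l \<in> E" unfolding E_def by blast
  moreover have "c \<le> l" if cE: "c \<in> E" for c
  proof -
    obtain v where "v \<noteq> 0" "A *v v = c *\<^sub>R v" using cE by (auto simp: E_def)
    then show ?thesis using l[of v] by simp
  qed
  ultimately have "lambda_max A = l"
    unfolding lambda_max_def E_def[symmetric]
    using finite_eigenvalues_sym[OF assms] by (intro Max_eqI) (auto simp: E_def)
  then show "A \<preceq> lambda_max A *\<^sub>R mat 1" using le by simp
  assume "A \<preceq> c *\<^sub>R mat 1"
  then have "0 \<le> u \<bullet> ((c *\<^sub>R mat 1 - A) *v u)" by (simp add: loewner_le_def)
  then have "u \<bullet> (A *v u) \<le> c" using u
    by (simp add: mult inner_diff_right flip: power2_norm_eq_inner)
  then show "lambda_max A \<le> c" using \<open>lambda_max A = l\<close> by (simp add: l_def)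
qed

lemma loewner_le_scaleR_mono:
  assumes "A \<preceq> a *\<^sub>R mat 1" "a \<le> b"
  shows "A \<preceq> b *\<^sub>R mat 1"
proof -
  have eq: "b *\<^sub>R mat 1 - A = (a *\<^sub>R mat 1 - A) + (b - a) *\<^sub>R mat 1"
    by (simp add: algebra_simps)
  show ?thesis using assms unfolding loewner_le_def eq
    by (auto intro!: sym_mat_add sym_mat_scaleR sym_mat_mat
        simp: matrix_vector_mult_add_rdistrib inner_add_right scaleR_matrix_vector_assoc[symmetric])
qed

section \<open>Smoothness of the problem data\<close>

lemma twice_cont_diffE:
  assumes "twice_cont_diff F"
  obtains F' where "\<And>x. (F has_derivative blinfun_apply (F' x)) (at x)" "\<And>x. isCont F' x"
  using assms unfolding twice_cont_diff_def
  by (metis has_derivative_continuous)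

lemma isCont_blinfun_applyI: "isCont F' x \<Longrightarrow> isCont (\<lambda>y. blinfun_apply (F' y) v) x"
  by (intro continuous_intros)

lemma twice_cont_diff_isCont: "twice_cont_diff F \<Longrightarrow> isCont F x"
  by (metis has_derivative_continuous twice_cont_diffE)

lemma isCont_jacobian:
  assumes "twice_cont_diff h"
  shows "isCont (Dh h) x"
proof -
  obtain h' where h': "\<And>x. (h has_derivative blinfun_apply (h' x)) (at x)" "\<And>x. isCont h' x"
    using twice_cont_diffE[OF assms] by metis
  have "Dh h = (\<lambda>x. \<chi> i j. h' x (axis j 1) $ i)"
    by (simp add: fun_eq_iff jacobian_def matrix_def frechet_derivative_at[OF h'(1), symmetric])
  then show ?thesis
    using isCont_blinfun_applyI[OF h'(2)] by (simp add: isCont_def tendsto_vec_lambda tendsto_vec_nth)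
qed

lemma isCont_partial_deriv:
  fixes G :: "real^'n \<Rightarrow> real^'m^'m"
  assumes "twice_cont_diff G"
  shows "isCont (partial_deriv G i) x"
proof -
  obtain G' where G': "\<And>x. (G has_derivative blinfun_apply (G' x)) (at x)" "\<And>x. isCont G' x"
    using twice_cont_diffE[OF assms] by metis
  have "partial_deriv G i = (\<lambda>x. G' x (axis i 1))"
  proof
    fix x :: "real^'n"
    have "((\<lambda>\<tau>. x + \<tau> *\<^sub>R axis i 1) has_derivative (\<lambda>\<tau>. \<tau> *\<^sub>R axis i 1)) (at 0)"
      by (auto intro!: derivative_eq_intros)
    from has_derivative_compose[OF this, of G "blinfun_apply (G' x)"]
    have "((\<lambda>\<tau>. G (x + \<tau> *\<^sub>R axis i 1)) has_vector_derivative G' x (axis i 1)) (at 0)"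
      using G'(1)[of x] by (simp add: has_vector_derivative_def blinfun.scaleR_right)
    then show "partial_deriv G i x = G' x (axis i 1)"
      unfolding partial_deriv_def by (rule vector_derivative_at)
  qed
  then show ?thesis using isCont_blinfun_applyI[OF G'(2)] by simp
qed

text \<open>The definite description in \<^const>\<open>gradient\<close> denotes the vector of partial derivatives because a
  derivative at a point, and hence the vector representing it, is unique.\<close>

lemma isCont_gradient:
  fixes f :: "real^'n \<Rightarrow> real"
  assumes "twice_cont_diff f"
  shows "isCont (gradient f) x"
proof -
  obtain f' where f': "\<And>x. (f has_derivative blinfun_apply (f' x)) (at x)" "\<And>x. isCont f' x"
    using twice_cont_diffE[OF assms] by metis
  have "gradient f = (\<lambda>x. \<chi> i. f' x (axis i 1))"
  proof
    fix x :: "real^'n"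
    let ?g = "\<chi> i. f' x (axis i 1)"
    have eq: "blinfun_apply (f' x) = (\<lambda>v. v \<bullet> ?g)"
    proof
      fix v :: "real^'n"
      have "f' x v = f' x (\<Sum>i\<in>UNIV. v $ i *\<^sub>R axis i 1)"
        using basis_expansion[of v] by (simp add: scalar_mult_eq_scaleR)
      then show "f' x v = v \<bullet> ?g"
        by (simp add: blinfun.sum_right blinfun.scaleR_right inner_vec_def)
    qed
    have "GDERIV f x :> ?g"
      unfolding gderiv_def by (rule has_derivative_eq_rhs[OF f'(1) eq])
    moreover have "g = ?g" if "GDERIV f x :> g" for g
    proof -
      have "(\<lambda>v. v \<bullet> g) = (\<lambda>v. v \<bullet> ?g)"
        using that \<open>GDERIV f x :> ?g\<close> unfolding gderiv_def by (rule has_derivative_unique)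
      then have "\<forall>v. v \<bullet> g = v \<bullet> ?g" by (rule fun_cong[THEN allI])
      then show ?thesis by (simp only: vector_eq_ldot vector_eq_rdot)
    qed
    ultimately show "gradient f x = ?g"
      unfolding gradient_def by (rule the_equality)
  qed
  then show ?thesis
    using isCont_blinfun_applyI[OF f'(2)] by (simp add: isCont_def tendsto_vec_lambda)
qed

lemma DG_add_scaleR: "DG G x (u + \<tau> *\<^sub>R v) = DG G x u + \<tau> *\<^sub>R DG G x v"
  and DG_zero: "DG G x 0 = 0"
  by (simp_all add: DG_def scaleR_left_distrib sum.distrib scaleR_sum_right)

lemma inner_adjoint:
  "(transpose J *v \<mu> + DG_adj G x Y) \<bullet> v = \<mu> \<bullet> (J *v v) + tr_inner Y (DG G x v)"
proof -
  have "DG_adj G x Y \<bullet> v = tr_inner Y (DG G x v)"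
    by (simp add: DG_adj_def DG_def inner_vec_def tr_inner_sum_right tr_inner_scaleR_right
        tr_inner_commute[of _ Y] mult.commute)
  then show ?thesis
    by (simp add: inner_add_left dot_lmul_matrix)
qed


section \<open>Limits of matrix expressions\<close>

lemma tendsto_matrix_vector_mult:
  fixes A :: "'a \<Rightarrow> real^'n^'m"
  assumes "(A \<longlongrightarrow> A0) F" "(v \<longlongrightarrow> v0) F"
  shows "((\<lambda>i. A i *v v i) \<longlongrightarrow> A0 *v v0) F"
  unfolding matrix_vector_mult_def
  by (intro tendsto_vec_lambda tendsto_intros assms)

lemma tendsto_transpose:
  fixes A :: "'a \<Rightarrow> real^'n^'m"
  assumes "(A \<longlongrightarrow> A0) F"
  shows "((\<lambda>i. transpose (A i)) \<longlongrightarrow> transpose A0) F"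
  unfolding transpose_def by (intro tendsto_vec_lambda tendsto_intros assms)

lemma tendsto_tr_inner:
  assumes "(A \<longlongrightarrow> A0) F" "(B \<longlongrightarrow> B0) F"
  shows "((\<lambda>i. tr_inner (A i) (B i)) \<longlongrightarrow> tr_inner A0 B0) F"
  unfolding tr_inner_def trace_def matrix_matrix_mult_def
  by (simp, intro tendsto_intros assms)

lemma tendsto_psd:
  assumes "Y \<longlonglongrightarrow> Y0" "\<And>i. 0 \<preceq> Y i"
  shows "0 \<preceq> Y0"
proof -
  have "transpose Y0 = Y0"
    using tendsto_transpose[OF assms(1)] assms
    by (simp add: psd_iff sym_mat_def LIMSEQ_unique)
  moreover have "0 \<le> v \<bullet> (Y0 *v v)" for v
  proof (rule LIMSEQ_le_const)
    show "(\<lambda>i. v \<bullet> (Y i *v v)) \<longlonglongrightarrow> v \<bullet> (Y0 *v v)"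
      by (intro tendsto_intros tendsto_matrix_vector_mult assms(1))
    show "\<exists>N. \<forall>i\<ge>N. 0 \<le> v \<bullet> (Y i *v v)"
      using assms(2) by (simp add: psd_iff)
  qed
  ultimately show ?thesis by (simp add: psd_iff sym_mat_def)
qed

lemma tendsto_DG_adj:
  assumes "twice_cont_diff G" "(z \<longlongrightarrow> z0) F" "(Y \<longlongrightarrow> Y0) F"
  shows "((\<lambda>i. DG_adj G (z i) (Y i)) \<longlongrightarrow> DG_adj G z0 Y0) F"
  unfolding DG_adj_def
  by (intro tendsto_vec_lambda tendsto_tr_inner assms(3)
      isCont_tendsto_compose[OF isCont_partial_deriv[OF assms(1)]] assms(2))

lemma tendsto_DG:
  assumes "twice_cont_diff G" "(z \<longlongrightarrow> z0) F" "(u \<longlongrightarrow> u0) F"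
  shows "((\<lambda>i. DG G (z i) (u i)) \<longlongrightarrow> DG G z0 u0) F"
  unfolding DG_def
  by (intro tendsto_intros isCont_tendsto_compose[OF isCont_partial_deriv[OF assms(1)]]
      assms(2,3))


section \<open>Singular multipliers\<close>

definition singular_multipliers ::
  "(real^'n \<Rightarrow> real^'l) \<Rightarrow> (real^'n \<Rightarrow> real^'m^'m) \<Rightarrow> real^'n \<Rightarrow> real^'l \<Rightarrow> real^'m^'m \<Rightarrow> bool" where
  "singular_multipliers h G x \<mu> Y \<longleftrightarrow>
     (\<mu>, Y) \<noteq> (0, 0) \<and> transpose (Dh h x) *v \<mu> + DG_adj G x Y = 0 \<and>
     0 \<preceq> Y \<and> tr_inner Y (G x) = 0"

lemma singular_multipliers_imp_FJ_point:
  assumes "singular_multipliers h G x \<mu> Y" "h x = 0" "G x \<preceq> 0"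
  shows "FJ_point f h G x"
  unfolding FJ_point_def
  by (rule exI[of _ 0]) (use assms in \<open>auto simp: singular_multipliers_def\<close>)

text \<open>Pairing the adjoint equation with a Robinson direction \<open>u\<close> gives \<open>\<langle>Y, G(x) + DG(x) u\<rangle> = 0\<close>, although
  the second factor is negative definite; so \<open>Y = 0\<close>, and full row rank leaves no \<open>\<mu> \<noteq> 0\<close>.\<close>

lemma singular_multipliers_imp_not_robinson_CQ:
  assumes "singular_multipliers h G x \<mu> Y"
  shows "\<not> robinson_CQ h G x"
proof
  assume "robinson_CQ h G x"
  then obtain u where rank: "rank (Dh h x) = CARD('b)" and u: "Dh h x *v u = 0"
    and neg: "loewner_less (G x + DG G x u) 0"
    by (auto simp: robinson_CQ_def)
  have nz: "\<mu> \<noteq> 0 \<or> Y \<noteq> 0" and adj: "transpose (Dh h x) *v \<mu> + DG_adj G x Y = 0"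
    and psd: "0 \<preceq> Y" and compl: "tr_inner Y (G x) = 0"
    using assms by (auto simp: singular_multipliers_def)
  have "tr_inner Y (DG G x u) = 0"
    using inner_adjoint[of "Dh h x" \<mu> G x Y u] adj u by simp
  then have 0: "tr_inner Y (- (G x + DG G x u)) = 0"
    using compl tr_inner_diff_right[of Y 0 "G x + DG G x u"]
    by (simp add: tr_inner_zero_right tr_inner_add_right)
  have "loewner_less 0 (- (G x + DG G x u))"
    using neg by (simp add: loewner_less_def)
  with tr_inner_psd_pd_pos[OF psd] 0 have Y: "Y = 0" by fastforce
  have "DG_adj G x 0 = 0"
    by (simp add: DG_adj_def vec_eq_iff tr_inner_zero_right)
  then have "transpose (Dh h x) *v \<mu> = transpose (Dh h x) *v 0"
    using adj Y by simp
  moreover have "inj ((*v) (transpose (Dh h x)))"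
    using rank by (simp add: full_rank_injective[symmetric] rank_transpose)
  ultimately have "\<mu> = 0" by (blast dest: injD)
  with Y nz show False by simp
qed

text \<open>If the multipliers did not tend to zero, a subsequence would stay bounded away from zero. Its
  normalisation has an accumulation point on the unit sphere, and dividing by a norm that is bounded
  below keeps the residual of the adjoint equation small; so the limit is a singular pair at
  \<open>z0\<close>. The argument covers bounded and unbounded multipliers alike.\<close>

lemma asymptotic_multipliers_tendsto_0:
  fixes \<mu> :: "nat \<Rightarrow> real^'l" and Y A :: "nat \<Rightarrow> real^'m^'m"
  assumes smooth: "twice_cont_diff h" "twice_cont_diff G" and z: "z \<longlonglongrightarrow> z0"
    and psd: "\<And>i. 0 \<preceq> Y i" and compl: "\<And>i. tr_inner (Y i) (A i) = 0" and A: "A \<longlonglongrightarrow> G z0"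
    and stat: "(\<lambda>i. transpose (Dh h (z i)) *v \<mu> i + DG_adj G (z i) (Y i)) \<longlonglongrightarrow> 0"
    and regular: "\<And>\<mu> Y. \<not> singular_multipliers h G z0 \<mu> Y"
  shows "(\<lambda>i. (\<mu> i, Y i)) \<longlonglongrightarrow> (0, 0)"
proof (rule ccontr)
  define p where "p i = (\<mu> i, Y i)" for i
  define q where "q i = p i /\<^sub>R norm (p i)" for i
  assume "\<not> (\<lambda>i. (\<mu> i, Y i)) \<longlonglongrightarrow> (0, 0)"
  then obtain c where c: "c > 0" and "\<exists>\<^sub>F i in sequentially. c \<le> norm (p i)"
    by (auto simp: tendsto_iff not_eventually p_def not_less zero_prod_def[symmetric])
  then have "infinite {i. c \<le> norm (p i)}"
    by (simp add: frequently_sequentially infinite_nat_iff_unbounded_le)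
  then obtain \<phi> :: "nat \<Rightarrow> nat" where \<phi>: "strict_mono \<phi>" "\<And>i. c \<le> norm (p (\<phi> i))"
    using infinite_enumerate[of "{i. c \<le> norm (p i)}"] by auto
  have "\<forall>i. (q \<circ> \<phi>) i \<in> sphere 0 1"
  proof
    fix i
    have "norm (p (\<phi> i)) \<noteq> 0" using \<phi>(2)[of i] c by linarith
    then show "(q \<circ> \<phi>) i \<in> sphere 0 1" by (simp add: q_def)
  qed
  with compact_sphere[of "0 :: (real^'l) \<times> (real^'m^'m)" 1] obtain q0 \<psi>
    where q0: "norm q0 = 1" and \<psi>: "strict_mono \<psi>" and lim: "((q \<circ> \<phi>) \<circ> \<psi>) \<longlonglongrightarrow> q0"
    unfolding compact_def by (metis mem_sphere_0)
  define \<theta> where "\<theta> = \<phi> \<circ> \<psi>"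
  have \<theta>: "strict_mono \<theta>" and big: "c \<le> norm (p (\<theta> i))" for i
    unfolding \<theta>_def using \<phi> \<psi> by (auto intro: strict_mono_o)
  have q: "(\<lambda>i. q (\<theta> i)) \<longlonglongrightarrow> q0" using lim by (simp add: o_def \<theta>_def)
  define a where "a i = inverse (norm (p (\<theta> i)))" for i
  have fq: "fst (q (\<theta> i)) = a i *\<^sub>R \<mu> (\<theta> i)" and sq: "snd (q (\<theta> i)) = a i *\<^sub>R Y (\<theta> i)" for i
    by (simp_all add: q_def p_def a_def)
  have a: "0 \<le> a i" "a i \<le> inverse c" for i
    using big[of i] c by (auto simp: a_def le_imp_inverse_le)
  note sub = LIMSEQ_subseq_LIMSEQ[OF _ \<theta>, unfolded o_def]
  note lims = sub[OF z] tendsto_fst[OF q] tendsto_snd[OF q]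
  have "singular_multipliers h G z0 (fst q0) (snd q0)"
    unfolding singular_multipliers_def
  proof (intro conjI)
    show "(fst q0, snd q0) \<noteq> (0, 0)" using q0 by (auto simp: zero_prod_def[symmetric])
    have "(\<lambda>i. a i *\<^sub>R (transpose (Dh h (z (\<theta> i))) *v \<mu> (\<theta> i) + DG_adj G (z (\<theta> i)) (Y (\<theta> i)))) \<longlonglongrightarrow> 0"
    proof (rule Lim_null_comparison)
      show "\<forall>\<^sub>F i in sequentially.
          norm (a i *\<^sub>R (transpose (Dh h (z (\<theta> i))) *v \<mu> (\<theta> i) + DG_adj G (z (\<theta> i)) (Y (\<theta> i))))
          \<le> inverse c * norm (transpose (Dh h (z (\<theta> i))) *v \<mu> (\<theta> i) + DG_adj G (z (\<theta> i)) (Y (\<theta> i)))"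
        using a by (simp add: mult_right_mono)
      show "(\<lambda>i. inverse c * norm (transpose (Dh h (z (\<theta> i))) *v \<mu> (\<theta> i) + DG_adj G (z (\<theta> i)) (Y (\<theta> i)))) \<longlonglongrightarrow> 0"
        using tendsto_mult_right_zero[OF tendsto_norm_zero[OF sub[OF stat]]] .
    qed
    also have "(\<lambda>i. a i *\<^sub>R (transpose (Dh h (z (\<theta> i))) *v \<mu> (\<theta> i) + DG_adj G (z (\<theta> i)) (Y (\<theta> i))))
      = (\<lambda>i. transpose (Dh h (z (\<theta> i))) *v fst (q (\<theta> i)) + DG_adj G (z (\<theta> i)) (snd (q (\<theta> i))))"
      by (simp add: fun_eq_iff fq sq matrix_vector_mult_scaleR scaleR_add_right DG_adj_def vec_eq_iff
          tr_inner_scaleR_right)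
    finally have "(\<lambda>i. transpose (Dh h (z (\<theta> i))) *v fst (q (\<theta> i)) + DG_adj G (z (\<theta> i)) (snd (q (\<theta> i)))) \<longlonglongrightarrow> 0" .
    moreover have "(\<lambda>i. transpose (Dh h (z (\<theta> i))) *v fst (q (\<theta> i)) + DG_adj G (z (\<theta> i)) (snd (q (\<theta> i))))
      \<longlonglongrightarrow> transpose (Dh h z0) *v fst q0 + DG_adj G z0 (snd q0)"
      by (intro tendsto_intros tendsto_matrix_vector_mult tendsto_transpose tendsto_DG_adj lims smooth
          isCont_tendsto_compose[OF isCont_jacobian])
    ultimately have "0 = transpose (Dh h z0) *v fst q0 + DG_adj G z0 (snd q0)"
      by (rule LIMSEQ_unique)
    then show "transpose (Dh h z0) *v fst q0 + DG_adj G z0 (snd q0) = 0" by (rule sym)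
    have "0 \<preceq> snd (q (\<theta> i))" for i
      using psd[of "\<theta> i"] a(1)[of i]
      by (simp add: sq psd_iff sym_mat_scaleR scaleR_matrix_vector_assoc[symmetric])
    then show "0 \<preceq> snd q0" by (rule tendsto_psd[OF lims(3)])
    have "(\<lambda>i. tr_inner (snd (q (\<theta> i))) (A (\<theta> i))) \<longlonglongrightarrow> tr_inner (snd q0) (G z0)"
      by (intro tendsto_tr_inner lims sub A)
    then show "tr_inner (snd q0) (G z0) = 0"
      by (simp add: sq tr_inner_scaleR_left compl LIMSEQ_const_iff)
  qed
  with regular show False by blast
qed

lemma tendsto_mult_size:
  assumes "(\<mu> \<longlongrightarrow> \<mu>0) F" "(Y \<longlongrightarrow> Y0) F"
  shows "((\<lambda>i. mult_size (\<mu> i) (Y i)) \<longlongrightarrow> mult_size \<mu>0 Y0) F"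
  unfolding mult_size_def trace_def
  by (intro tendsto_intros tendsto_infnorm assms)


section \<open>Optimality conditions of the feasibility subproblem\<close>

text \<open>The Lagrangian is a quadratic function, so its partial derivatives can be read off from its
  expansion along lines.\<close>

lemma zero_derivative_imp_zero_slope:
  fixes L :: "'a::real_normed_vector \<Rightarrow> real"
  assumes "(L has_derivative (\<lambda>_. 0)) (at p)"
    and "\<And>\<tau>. L (p + \<tau> *\<^sub>R q) = L p + \<tau> * c + \<tau>\<^sup>2 * k"
  shows "c = 0"
proof -
  have "((\<lambda>\<tau>. p + \<tau> *\<^sub>R q) has_derivative (\<lambda>\<tau>. \<tau> *\<^sub>R q)) (at 0)"
    by (auto intro!: derivative_eq_intros)
  from has_derivative_compose[OF this, of L "\<lambda>_. 0"] assms
  have "((\<lambda>\<tau>. L p + \<tau> * c + \<tau>\<^sup>2 * k) has_derivative (\<lambda>_. 0)) (at 0)"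
    by simp
  moreover have "((\<lambda>\<tau>. L p + \<tau> * c + \<tau>\<^sup>2 * k) has_derivative (\<lambda>\<tau>. \<tau> * c)) (at 0)"
    by (auto intro!: derivative_eq_intros)
  ultimately have "(\<lambda>_. 0) = (\<lambda>\<tau>. \<tau> * c)" by (rule has_derivative_unique)
  then show ?thesis by (metis mult_1)
qed

lemma fea_multipliers_stationary:
  fixes h :: "real^'n \<Rightarrow> real^'l" and G :: "real^'n \<Rightarrow> real^'m^'m"
  assumes "fea_multipliers h G x Bf d r s t \<mu> Y" "sym_mat Bf"
  shows "Bf *v d + (transpose (Dh h x) *v \<mu> + DG_adj G x Y) = 0"
proof -
  obtain \<nu>r \<nu>s \<nu>t where deriv:
    "(fea_lagrangian h G x Bf \<mu> Y \<nu>r \<nu>s \<nu>t has_derivative (\<lambda>_. 0)) (at (d, r, s, t))"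
    using assms(1) by (auto simp: fea_multipliers_def)
  let ?g = "Bf *v d + (transpose (Dh h x) *v \<mu> + DG_adj G x Y)"
  have "?g \<bullet> v = 0" for v
  proof (rule zero_derivative_imp_zero_slope[OF deriv, where q = "(v, 0, 0, 0)"])
    fix \<tau>
    have slope: "?g \<bullet> v = d \<bullet> (Bf *v v) + (\<mu> \<bullet> (Dh h x *v v) + tr_inner Y (DG G x v))"
      using sym_mat_inner_commute[OF assms(2), of v d]
      by (simp only: inner_add_left[of "Bf *v d"] inner_adjoint inner_commute[of "Bf *v d"])
    show "fea_lagrangian h G x Bf \<mu> Y \<nu>r \<nu>s \<nu>t ((d, r, s, t) + \<tau> *\<^sub>R (v, 0, 0, 0))
      = fea_lagrangian h G x Bf \<mu> Y \<nu>r \<nu>s \<nu>t (d, r, s, t) + \<tau> * (?g \<bullet> v)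
        + \<tau>\<^sup>2 * (1/2 * (v \<bullet> (Bf *v v)))"
      unfolding slope using sym_mat_inner_commute[OF assms(2), of v d]
      by (simp add: fea_lagrangian_def fea_obj_def quadratic_form_add_scaleR[OF assms(2)]
          DG_add_scaleR matrix_vector_right_distrib matrix_vector_mult_scaleR tr_inner_add_right
          tr_inner_diff_right tr_inner_scaleR_right inner_add_right inner_diff_right
          algebra_simps power2_eq_square)
  qed
  from this[of ?g] show ?thesis by (simp only: inner_eq_zero_iff)
qed

text \<open>Stationarity in the slacks reads \<open>\<nu>r = e - \<mu>\<close>, \<open>\<nu>s = e + \<mu>\<close> and \<open>\<nu>t = 1 - tr Y\<close>. For small
  \<open>\<mu>\<close> and \<open>Y\<close> all of these are strictly positive, and complementarity makes the slacks vanish.\<close>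

lemma fea_multipliers_small_imp_zero_slack:
  fixes h :: "real^'n \<Rightarrow> real^'l" and G :: "real^'n \<Rightarrow> real^'m^'m"
  assumes mult: "fea_multipliers h G x Bf d r s t \<mu> Y"
    and small: "mult_size \<mu> Y < 1"
    and nonneg: "0 \<le> r" "0 \<le> s" "0 \<le> t"
  shows "r = 0" "s = 0" "t = 0"
proof -
  obtain \<nu>r \<nu>s \<nu>t where \<nu>: "0 \<le> \<nu>r" "0 \<le> \<nu>s" "\<nu>r \<bullet> r = 0" "\<nu>s \<bullet> s = 0" "\<nu>t * t = 0"
    and deriv:
    "(fea_lagrangian h G x Bf \<mu> Y \<nu>r \<nu>s \<nu>t has_derivative (\<lambda>_. 0)) (at (d, r, s, t))"
    using mult by (auto simp: fea_multipliers_def)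
  have psd: "0 \<preceq> Y" using mult by (simp add: fea_multipliers_def)
  have \<mu>: "\<bar>\<mu> $ i\<bar> < 1" for i
  proof -
    have "\<bar>\<mu> $ i\<bar> \<le> infnorm \<mu>"
      by (rule component_le_infnorm_cart)
    then show ?thesis using small psd_trace_nonneg[OF psd] by (simp add: mult_size_def)
  qed
  have Y: "trace Y < 1"
    using small infnorm_pos_le[of \<mu>] by (simp add: mult_size_def)
  have "1 - \<mu> $ i - \<nu>r $ i = 0" for i
    by (rule zero_derivative_imp_zero_slope[OF deriv, where q = "(0, axis i 1, 0, 0)" and k = 0])
      (simp add: fea_lagrangian_def fea_obj_def inner_add_right inner_diff_right inner_axis algebra_simps)
  then have r: "0 < \<nu>r $ i" for i
    using \<mu>[of i] by (smt (verit))
  have "1 + \<mu> $ i - \<nu>s $ i = 0" for i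
    by (rule zero_derivative_imp_zero_slope[OF deriv, where q = "(0, 0, axis i 1, 0)" and k = 0])
      (simp add: fea_lagrangian_def fea_obj_def inner_add_right inner_diff_right inner_axis algebra_simps)
  then have s: "0 < \<nu>s $ i" for i
    using \<mu>[of i] by (smt (verit))
  have "1 - trace Y - \<nu>t = 0"
    by (rule zero_derivative_imp_zero_slope[OF deriv, where q = "(0, 0, 0, 1)" and k = 0])
      (simp add: fea_lagrangian_def fea_obj_def tr_inner_diff_right tr_inner_scaleR_right tr_inner_mat_1_right algebra_simps)
  then show "t = 0" using Y \<nu>(5) by auto
  have zero: "w = 0" if "\<And>i. 0 < \<nu> $ i" "\<nu> \<bullet> w = 0" "0 \<le> w" for \<nu> w :: "real^'l"
  proof -
    have w: "0 \<le> w $ i" for i using that(3) by (simp add: less_eq_vec_def)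
    have "(\<Sum>i\<in>UNIV. \<nu> $ i * w $ i) = 0"
      using that(2) by (simp add: inner_vec_def)
    then have "\<forall>i\<in>UNIV. \<nu> $ i * w $ i = 0"
      by (subst (asm) sum_nonneg_eq_0_iff) (use w that(1) in \<open>auto intro: mult_nonneg_nonneg less_imp_le\<close>)
    then show ?thesis using that(1) by (simp add: vec_eq_iff) (metis less_irrefl)
  qed
  show "r = 0" by (rule zero[OF r \<nu>(3) nonneg(1)])
  show "s = 0" by (rule zero[OF s \<nu>(4) nonneg(2)])
qed

section \<open>One iteration of the algorithm\<close>

lemma norm1_nonneg: "0 \<le> norm1 u"
  by (simp add: norm1_def sum_nonneg)

lemma viol_nonneg: "0 \<le> viol h G x"
  by (simp add: viol_def norm1_nonneg)

lemma inner_le_infnorm_mult_norm1: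
  fixes u w :: "real^'n"
  shows "u \<bullet> w \<le> infnorm u * norm1 w"
proof -
  have "u $ i * w $ i \<le> infnorm u * \<bar>w $ i\<bar>" for i
    using mult_right_mono[OF component_le_infnorm_cart[of u i], of "\<bar>w $ i\<bar>"]
    by (metis abs_ge_self abs_ge_zero abs_mult order_trans)
  then show ?thesis
    by (simp add: inner_vec_def norm1_def sum_distrib_left sum_mono)
qed

text \<open>Duality of the norms \<open>\<parallel>\<cdot>\<parallel>\<^sub>\<infinity>\<close> and \<open>\<parallel>\<cdot>\<parallel>\<^sub>1\<close>, and of trace and largest eigenvalue on the positive
  semidefinite cone. This is why the algorithm measures multipliers by \<^const>\<open>mult_size\<close>.\<close>

lemma multiplier_pairing_le:
  assumes "0 \<preceq> Y" "sym_mat (G x)"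
  shows "\<mu> \<bullet> h x + tr_inner Y (G x) \<le> mult_size \<mu> Y * viol h G x"
proof -
  define a b v w where "a = infnorm \<mu>" and "b = trace Y" and "v = norm1 (h x)"
    and "w = max 0 (lambda_max (G x))"
  have nonneg: "0 \<le> a" "0 \<le> b" "0 \<le> v" "0 \<le> w"
    by (simp_all add: a_def b_def v_def w_def infnorm_pos_le psd_trace_nonneg assms norm1_nonneg)
  have "\<mu> \<bullet> h x \<le> a * v"
    unfolding a_def v_def by (rule inner_le_infnorm_mult_norm1)
  moreover have "G x \<preceq> w *\<^sub>R mat 1"
    by (rule loewner_le_scaleR_mono[OF loewner_le_lambda_max[OF assms(2)]]) (simp add: w_def)
  then have "tr_inner Y (G x) \<le> w * b"
    unfolding b_def by (rule tr_inner_le_trace_mult[OF assms(1)])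
  moreover have "0 \<le> a * w" "0 \<le> b * v" using nonneg by simp_all
  ultimately have "\<mu> \<bullet> h x + tr_inner Y (G x) \<le> (a + b) * (v + w)"
    by (simp add: algebra_simps)
  then show ?thesis
    by (simp add: mult_size_def viol_def a_def b_def v_def w_def)
qed

text \<open>The violation is the objective value at \<open>d = 0\<close> with the smallest admissible slacks.\<close>

lemma fea_obj_le_viol:
  fixes h :: "real^'n \<Rightarrow> real^'l" and G :: "real^'n \<Rightarrow> real^'m^'m"
  assumes opt: "is_arg_min (fea_obj Bf) (fea_constr h G x) p" and sym: "sym_mat (G x)"
  shows "fea_obj Bf p \<le> viol h G x"
proof -
  define r0 s0 :: "real^'l" where "r0 = (\<chi> i. max 0 (h x $ i))" and "s0 = (\<chi> i. max 0 (- h x $ i))"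
  define t0 where "t0 = max 0 (lambda_max (G x))"
  have "G x \<preceq> t0 *\<^sub>R mat 1"
    by (rule loewner_le_scaleR_mono[OF loewner_le_lambda_max[OF sym]]) (simp add: t0_def)
  moreover have "h x = r0 - s0"
    by (simp add: r0_def s0_def vec_eq_iff max_def)
  ultimately have "fea_constr h G x (0, r0, s0, t0)"
    by (simp add: fea_constr_def DG_zero less_eq_vec_def t0_def) (simp add: r0_def s0_def)
  then have "fea_obj Bf p \<le> fea_obj Bf (0, r0, s0, t0)"
    using opt by (auto simp: is_arg_min_def not_less)
  also have "\<dots> = viol h G x"
    by (simp add: fea_obj_def viol_def t0_def norm1_def inner_vec_def r0_def s0_def)
      (rule sum.cong, auto)
  finally show ?thesis .
qed

lemma fea_opt_bounds:
  assumes opt: "is_arg_min (fea_obj Bf) (fea_constr h G x) (d, r, s, t)"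
    and sym: "sym_mat (G x)" and psd: "0 \<preceq> Bf"
  shows "t \<le> viol h G x" "1 / 2 * (d \<bullet> (Bf *v d)) \<le> viol h G x"
proof -
  have nonneg: "0 \<le> r" "0 \<le> s" "0 \<le> t"
    using opt by (auto simp: is_arg_min_def fea_constr_def)
  have "0 \<le> vec 1 \<bullet> (r + s)"
    using nonneg(1,2) by (simp add: inner_vec_def less_eq_vec_def sum_nonneg)
  moreover have "0 \<le> d \<bullet> (Bf *v d)" using psd by (simp add: psd_iff)
  ultimately show "t \<le> viol h G x" "1 / 2 * (d \<bullet> (Bf *v d)) \<le> viol h G x"
    using fea_obj_le_viol[OF opt sym] nonneg(3) by (simp_all add: fea_obj_def)
qed

text \<open>The solution \<open>df\<close> of the feasibility problem is feasible for the second subproblem, so the optimal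
  value there is at most the value at \<open>df\<close>.\<close>

lemma qp_step_bound:
  assumes fea: "fea_constr h G x (df, r, s, t)"
    and opt: "is_arg_min (qp_obj f \<rho> x B) (qp_constr h G x r s t) d"
    and B: "b\<^sub>1 * (norm d)\<^sup>2 \<le> d \<bullet> (B *v d)" "df \<bullet> (B *v df) \<le> b\<^sub>2 * (norm df)\<^sup>2"
  defines "a \<equiv> norm (\<rho> *\<^sub>R gradient f x)"
  shows "b\<^sub>1 / 2 * (norm d)\<^sup>2 \<le> a * norm d + (a * norm df + b\<^sub>2 / 2 * (norm df)\<^sup>2)"
proof -
  have "qp_constr h G x r s t df"
    using fea by (simp add: fea_constr_def qp_constr_def)
  then have "qp_obj f \<rho> x B d \<le> qp_obj f \<rho> x B df"
    using opt by (auto simp: is_arg_min_def not_less)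
  moreover have "\<bar>(\<rho> *\<^sub>R gradient f x) \<bullet> v\<bar> \<le> a * norm v" for v
    unfolding a_def by (rule Cauchy_Schwarz_ineq2)
  from this[of d] this[of df] have "- (a * norm d) \<le> \<rho> * (gradient f x \<bullet> d)"
    "\<rho> * (gradient f x \<bullet> df) \<le> a * norm df"
    by auto
  ultimately show ?thesis using B by (simp add: qp_obj_def)
qed

text \<open>With vanishing slacks the step \<open>d\<close> removes the whole linearised violation, so that
  \<open>\<Delta>l\<^sup>v(d)\<close> equals the violation. Stationarity paired with \<open>d\<close>, where feasibility and
  complementarity replace \<open>Dh(x) d\<close> by \<open>- h(x)\<close> and \<open>\<langle>Y, DG(x) d\<rangle>\<close> by \<open>- \<langle>Y, G(x)\<rangle>\<close>, bounds
  \<open>\<rho> g\<^sup>T d\<close> by \<open>(1 - \<epsilon>)\<close> times the violation. That is the negation of the second test.\<close>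

lemma rho_next_eq_if_small_multipliers:
  assumes qp: "qp_constr h G x 0 0 0 d" and mult: "qp_multipliers f h G \<rho> x B 0 d \<mu> Y"
    and B: "0 \<preceq> B" and sym: "sym_mat (G x)"
    and small: "mult_size \<mu> Y \<le> 1 - \<epsilon>"
    and test: "\<rho> * a \<le> 1" "\<rho> * mult_size \<mu> Y \<le> 1"
  shows "rho_next f h G \<epsilon> \<delta> x B d (rho_trial \<epsilon> \<delta> \<rho> a (mult_size \<mu> Y)) = \<rho>"
proof -
  have lin: "h x + Dh h x *v d = 0" and le: "G x + DG G x d \<preceq> 0"
    using qp by (simp_all add: qp_constr_def)
  have stat: "\<rho> *\<^sub>R gradient f x + B *v d + (transpose (Dh h x) *v \<mu> + DG_adj G x Y) = 0"
    and psd: "0 \<preceq> Y" and compl: "tr_inner Y (G x) + tr_inner Y (DG G x d) = 0"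
    using mult by (simp_all add: qp_multipliers_def add.assoc tr_inner_add_right)
  have "sym_mat (G x + DG G x d)"
    using sym_mat_scaleR[of "0 - (G x + DG G x d)" "-1"] le by (simp add: loewner_le_def add.commute)
  then have "lambda_max (G x + DG G x d) \<le> 0"
    by (rule lambda_max_le) (use le in simp)
  then have viol: "dlin_viol h G x d = viol h G x"
    by (simp add: dlin_viol_def lin_viol_def viol_def lin norm1_def DG_zero)
  have quad: "0 \<le> d \<bullet> (B *v d)" using B by (simp add: psd_iff)
  have "0 = (\<rho> *\<^sub>R gradient f x + B *v d + (transpose (Dh h x) *v \<mu> + DG_adj G x Y)) \<bullet> d"
    by (simp only: stat inner_zero_left)
  also have "\<dots> = \<rho> * (gradient f x \<bullet> d) + d \<bullet> (B *v d) + (\<mu> \<bullet> (Dh h x *v d) + tr_inner Y (DG G x d))"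
    by (simp only: inner_add_left[of "\<rho> *\<^sub>R gradient f x + B *v d"] inner_adjoint)
      (simp add: inner_add_left inner_commute[of _ d] inner_add_right)
  also have "Dh h x *v d = - h x" using lin by (simp add: eq_neg_iff_add_eq_0 add.commute)
  finally have "\<rho> * (gradient f x \<bullet> d) = - (d \<bullet> (B *v d)) + (\<mu> \<bullet> h x + tr_inner Y (G x))"
    using compl by simp
  also have "\<dots> \<le> mult_size \<mu> Y * viol h G x"
    using multiplier_pairing_le[where G = G and x = x and h = h and \<mu> = \<mu>, OF psd sym] quad by linarith
  also have "\<dots> \<le> (1 - \<epsilon>) * viol h G x"
    by (rule mult_right_mono[OF small viol_nonneg])
  finally show ?thesis using test
    by (simp add: rho_trial_def rho_next_def dlin_pen_def viol algebra_simps)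
qed


section \<open>Limits of the iterates\<close>

lemma viol_tendsto_0_imp_feasible:
  assumes smooth: "twice_cont_diff h" "twice_cont_diff G" and sym: "\<And>y. sym_mat (G y)"
    and z: "z \<longlonglongrightarrow> z0" and viol: "(\<lambda>i. viol h G (z i)) \<longlonglongrightarrow> 0"
  shows "h z0 = 0" "G z0 \<preceq> 0"
proof -
  have h: "(\<lambda>i. h (z i)) \<longlonglongrightarrow> h z0" and G: "(\<lambda>i. G (z i)) \<longlonglongrightarrow> G z0"
    by (rule isCont_tendsto_compose[OF twice_cont_diff_isCont z], rule smooth)+
  have "norm (h x) \<le> viol h G x" for x
    using norm_le_l1_cart[of "h x"] by (simp add: viol_def norm1_def)
  then have "(\<lambda>i. h (z i)) \<longlonglongrightarrow> 0"
    by (intro Lim_null_comparison[OF _ viol]) simp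
  then show "h z0 = 0" using h by (metis LIMSEQ_unique)
  have "(\<lambda>i. viol h G (z i) *\<^sub>R mat 1 - G (z i)) \<longlonglongrightarrow> 0 *\<^sub>R mat 1 - G z0"
    by (intro tendsto_intros viol G)
  moreover have "0 \<preceq> viol h G x *\<^sub>R mat 1 - G x" for x
  proof -
    have "G x \<preceq> viol h G x *\<^sub>R mat 1"
      by (rule loewner_le_scaleR_mono[OF loewner_le_lambda_max[OF sym]])
        (use norm1_nonneg[of "h x"] in \<open>simp add: viol_def\<close>)
    then show ?thesis by (simp add: loewner_le_def)
  qed
  ultimately have "0 \<preceq> 0 *\<^sub>R mat 1 - G z0" by (rule tendsto_psd)
  then show "G z0 \<preceq> 0" by (simp add: loewner_le_def)
qed

text \<open>The linear term is absorbed by \<open>a n \<le> a\<^sup>2 / b + b n\<^sup>2 / 4\<close>.\<close>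

lemma quadratic_bound_tendsto_0:
  fixes a c :: "nat \<Rightarrow> real"
  assumes "0 < b" and lims: "a \<longlonglongrightarrow> 0" "c \<longlonglongrightarrow> 0"
    and bound: "\<And>i. b / 2 * (norm (u i))\<^sup>2 \<le> a i * norm (u i) + c i"
  shows "u \<longlonglongrightarrow> 0"
proof -
  have "(norm (u i))\<^sup>2 \<le> 4 / b * ((a i)\<^sup>2 / b + c i)" for i
  proof -
    define n where "n = norm (u i)"
    have "0 \<le> (2 * a i - b * n)\<^sup>2" by simp
    then have "b * (a i * n) \<le> (a i)\<^sup>2 + b * (b * n\<^sup>2 / 4)"
      by (simp add: power2_eq_square algebra_simps)
    then have "a i * n \<le> (a i)\<^sup>2 / b + b * n\<^sup>2 / 4"
      using \<open>0 < b\<close> by (simp add: field_simps)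
    moreover have "2 * (b * n\<^sup>2 / 4) \<le> a i * n + c i"
      using bound[of i] by (simp add: n_def)
    ultimately have "b * n\<^sup>2 / 4 \<le> (a i)\<^sup>2 / b + c i"
      by linarith
    then have "4 / b * (b * n\<^sup>2 / 4) \<le> 4 / b * ((a i)\<^sup>2 / b + c i)"
      using \<open>0 < b\<close> by (intro mult_left_mono) auto
    then show ?thesis using \<open>0 < b\<close> by (simp add: n_def)
  qed
  then have "\<forall>\<^sub>F i in sequentially. norm ((norm (u i))\<^sup>2) \<le> 4 / b * ((a i)\<^sup>2 / b + c i)"
    by (intro always_eventually allI) (metis real_norm_def abs_power2)
  moreover have "(\<lambda>i. 4 / b * ((a i)\<^sup>2 / b + c i)) \<longlonglongrightarrow> 4 / b * (0\<^sup>2 / b + 0)"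
    by (intro tendsto_intros lims) (use \<open>0 < b\<close> in simp)
  then have "(\<lambda>i. 4 / b * ((a i)\<^sup>2 / b + c i)) \<longlonglongrightarrow> 0" by simp
  ultimately have "(\<lambda>i. (norm (u i))\<^sup>2) \<longlonglongrightarrow> 0"
    by (rule Lim_null_comparison)
  from tendsto_real_sqrt[OF this] show ?thesis
    by (simp add: tendsto_norm_zero_iff)
qed

lemma psd_matrix_vector_tendsto_0:
  assumes "\<And>i. 0 \<preceq> B i" "\<And>i u. u \<bullet> (B i *v u) \<le> b * (norm u)\<^sup>2" "d \<longlonglongrightarrow> 0"
  shows "(\<lambda>i. B i *v d i) \<longlonglongrightarrow> 0"
proof (rule Lim_null_comparison)
  show "\<forall>\<^sub>F i in sequentially. norm (B i *v d i) \<le> b * norm (d i)"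
    using psd_norm_matrix_vector_le[OF assms(1,2)] by simp
  show "(\<lambda>i. b * norm (d i)) \<longlonglongrightarrow> 0"
    using tendsto_mult_right_zero[OF tendsto_norm_zero[OF assms(3)]] .
qed

theorem theorem15:
  fixes f :: "real^'n \<Rightarrow> real" and h :: "real^'n \<Rightarrow> real^'l" and G :: "real^'n \<Rightarrow> real^'m^'m"
    and \<epsilon> \<delta> \<eta> \<gamma> b\<^sub>1 b\<^sub>2 :: real and \<Omega> :: "(real^'n) set"
    and x d df :: "nat \<Rightarrow> real^'n" and \<rho> t \<alpha> :: "nat \<Rightarrow> real"
    and Bf B :: "nat \<Rightarrow> real^'n^'n"
    and r s \<mu>b \<mu>h :: "nat \<Rightarrow> real^'l" and Yb Yh :: "nat \<Rightarrow> real^'m^'m"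
    and xs :: "real^'n"
  assumes G_sym: "\<And>y. sym_mat (G y)"
    and params: "0 < \<epsilon>" "\<epsilon> < 1" "0 < \<delta>" "\<delta> < 1" "0 < \<eta>" "\<eta> < 1" "0 < \<gamma>" "\<gamma> < 1"
    and run: "sqp_run f h G \<epsilon> \<delta> \<eta> \<gamma> x \<rho> Bf B df r s t \<mu>b Yb d \<mu>h Yh \<alpha>"
    and A1: "twice_cont_diff f" "twice_cont_diff h" "twice_cont_diff G"
    and A2: "convex \<Omega>" "compact \<Omega>" "\<And>k. x k \<in> \<Omega>"
    and A3: "0 < b\<^sub>1" "b\<^sub>1 < b\<^sub>2"
      "\<And>k u. b\<^sub>1 * (norm u)\<^sup>2 \<le> u \<bullet> (Bf k *v u) \<and> u \<bullet> (Bf k *v u) \<le> b\<^sub>2 * (norm u)\<^sup>2"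
      "\<And>k u. b\<^sub>1 * (norm u)\<^sup>2 \<le> u \<bullet> (B k *v u) \<and> u \<bullet> (B k *v u) \<le> b\<^sub>2 * (norm u)\<^sup>2"
    and rho_lim: "\<rho> \<longlonglongrightarrow> 0"
    and viol_lim: "(\<lambda>k. viol h G (x k)) \<longlonglongrightarrow> 0"
    and accum: "subseq_accum_point x {k. \<rho> (Suc k) < \<rho> k} xs"
  shows "FJ_point f h G xs \<and> \<not> robinson_CQ h G xs"
proof -
  obtain \<phi> where \<phi>: "strict_mono \<phi>" and updated: "\<And>i. \<rho> (Suc (\<phi> i)) < \<rho> (\<phi> i)"
    and "(x \<circ> \<phi>) \<longlonglongrightarrow> xs"
    using accum by (auto simp: subseq_accum_point_def)
  then have z: "(\<lambda>i. x (\<phi> i)) \<longlonglongrightarrow> xs" by (simp add: o_def)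
  have rho: "(\<lambda>i. \<rho> (\<phi> i)) \<longlonglongrightarrow> 0" and viol: "(\<lambda>i. viol h G (x (\<phi> i))) \<longlonglongrightarrow> 0"
    using LIMSEQ_subseq_LIMSEQ[OF rho_lim \<phi>] LIMSEQ_subseq_LIMSEQ[OF viol_lim \<phi>]
    by (simp_all add: o_def)
  note feasible = viol_tendsto_0_imp_feasible[OF A1(2,3) G_sym z viol]
  have sym: "sym_mat (Bf k)" "sym_mat (B k)" for k
    using run by (auto simp: sqp_run_def loewner_less_def)
  have "0 \<le> b\<^sub>1 * (norm u)\<^sup>2" for u :: "real^'n" using \<open>0 < b\<^sub>1\<close> by simp
  then have "0 \<le> u \<bullet> (Bf k *v u)" "0 \<le> u \<bullet> (B k *v u)" for k u
    using A3(3,4)[where u = u and k = k] by (meson order_trans)+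
  with sym have psd: "0 \<preceq> Bf k" "0 \<preceq> B k" for k
    by (simp_all add: psd_iff)
  have fea: "is_arg_min (fea_obj (Bf k)) (fea_constr h G (x k)) (df k, r k, s k, t k)"
    and fea_mult: "fea_multipliers h G (x k) (Bf k) (df k) (r k) (s k) (t k) (\<mu>b k) (Yb k)"
    and qp: "is_arg_min (qp_obj f (\<rho> k) (x k) (B k)) (qp_constr h G (x k) (r k) (s k) (t k)) (d k)"
    and qp_mult: "qp_multipliers f h G (\<rho> k) (x k) (B k) (t k) (d k) (\<mu>h k) (Yh k)"
    and rho_Suc: "\<rho> (Suc k) = rho_next f h G \<epsilon> \<delta> (x k) (B k) (d k)
      (rho_trial \<epsilon> \<delta> (\<rho> k) (mult_size (\<mu>b k) (Yb k)) (mult_size (\<mu>h k) (Yh k)))" for k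
    using run by (simp_all add: sqp_run_def)
  have fea_constr: "fea_constr h G (x k) (df k, r k, s k, t k)" for k
    using fea[of k] by (simp add: is_arg_min_def)
  then have nonneg: "0 \<le> r k" "0 \<le> s k" "0 \<le> t k" for k
    by (simp_all add: fea_constr_def)

  have t: "(\<lambda>i. t (\<phi> i)) \<longlonglongrightarrow> 0"
    by (rule Lim_null_comparison[OF _ viol])
      (simp add: nonneg fea_opt_bounds(1)[OF fea G_sym psd(1)])
  have df: "(\<lambda>i. df (\<phi> i)) \<longlonglongrightarrow> 0"
  proof (rule quadratic_bound_tendsto_0[OF \<open>0 < b\<^sub>1\<close> tendsto_const viol])
    fix i
    show "b\<^sub>1 / 2 * (norm (df (\<phi> i)))\<^sup>2 \<le> 0 * norm (df (\<phi> i)) + viol h G (x (\<phi> i))"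
      using fea_opt_bounds(2)[OF fea G_sym psd(1), of "\<phi> i"] A3(3)[of "df (\<phi> i)" "\<phi> i"] by simp
  qed
  have rho_grad: "(\<lambda>i. \<rho> (\<phi> i) *\<^sub>R gradient f (x (\<phi> i))) \<longlonglongrightarrow> 0"
    using tendsto_scaleR[OF rho isCont_tendsto_compose[OF isCont_gradient[OF A1(1)] z]] by simp
  have d: "(\<lambda>i. d (\<phi> i)) \<longlonglongrightarrow> 0"
  proof (rule quadratic_bound_tendsto_0[OF \<open>0 < b\<^sub>1\<close>])
    let ?a = "\<lambda>i. norm (\<rho> (\<phi> i) *\<^sub>R gradient f (x (\<phi> i)))"
    show a: "?a \<longlonglongrightarrow> 0" by (rule tendsto_norm_zero[OF rho_grad])
    have "(\<lambda>i. ?a i * norm (df (\<phi> i)) + b\<^sub>2 / 2 * (norm (df (\<phi> i)))\<^sup>2)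
      \<longlonglongrightarrow> 0 * 0 + b\<^sub>2 / 2 * 0\<^sup>2"
      by (intro tendsto_intros a tendsto_norm_zero[OF df])
    then show "(\<lambda>i. ?a i * norm (df (\<phi> i)) + b\<^sub>2 / 2 * (norm (df (\<phi> i)))\<^sup>2) \<longlonglongrightarrow> 0"
      by simp
    show "b\<^sub>1 / 2 * (norm (d (\<phi> i)))\<^sup>2 \<le> ?a i * norm (d (\<phi> i))
      + (?a i * norm (df (\<phi> i)) + b\<^sub>2 / 2 * (norm (df (\<phi> i)))\<^sup>2)" for i
      by (rule qp_step_bound[OF fea_constr qp]) (use A3(4) in auto)
  qed
  have G_lim: "(\<lambda>i. G (x (\<phi> i)) + DG G (x (\<phi> i)) (u (\<phi> i)) - t (\<phi> i) *\<^sub>R mat 1) \<longlonglongrightarrow> G xs"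
    if u: "(\<lambda>i. u (\<phi> i)) \<longlonglongrightarrow> 0" for u
  proof -
    have "(\<lambda>i. G (x (\<phi> i)) + DG G (x (\<phi> i)) (u (\<phi> i)) - t (\<phi> i) *\<^sub>R mat 1)
      \<longlonglongrightarrow> G xs + DG G xs 0 - 0 *\<^sub>R mat 1"
      by (intro tendsto_intros tendsto_DG A1 z u t
          isCont_tendsto_compose[OF twice_cont_diff_isCont[OF A1(3)]])
    then show ?thesis by (simp add: DG_zero)
  qed

  have "\<exists>\<mu> Y. singular_multipliers h G xs \<mu> Y"
  proof (rule ccontr)
    assume "\<nexists>\<mu> Y. singular_multipliers h G xs \<mu> Y"
    then have regular: "\<And>\<mu> Y. \<not> singular_multipliers h G xs \<mu> Y" by blast
    \<comment> \<open>Applied below to the multipliers of both subproblems, with \<open>u\<close> the respective direction.\<close>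
    have small: "(\<lambda>i. mult_size (\<mu> (\<phi> i)) (Y (\<phi> i))) \<longlonglongrightarrow> 0"
      if "\<And>k. 0 \<preceq> Y k" and "\<And>k. tr_inner (Y k) (G (x k) + DG G (x k) (u k) - t k *\<^sub>R mat 1) = 0"
        and "(\<lambda>i. u (\<phi> i)) \<longlonglongrightarrow> 0"
        and "(\<lambda>i. transpose (Dh h (x (\<phi> i))) *v \<mu> (\<phi> i) + DG_adj G (x (\<phi> i)) (Y (\<phi> i))) \<longlonglongrightarrow> 0"
      for \<mu> Y u
    proof -
      have "(\<lambda>i. (\<mu> (\<phi> i), Y (\<phi> i))) \<longlonglongrightarrow> (0, 0)"
        by (rule asymptotic_multipliers_tendsto_0[OF A1(2,3) z that(1,2) G_lim[OF that(3)] that(4) regular])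
      from tendsto_mult_size[OF tendsto_fst[OF this] tendsto_snd[OF this]] show ?thesis
        by (simp add: mult_size_def trace_def infnorm_0)
    qed
    have "transpose (Dh h (x k)) *v \<mu>b k + DG_adj G (x k) (Yb k) = - (Bf k *v df k)" for k
      using fea_multipliers_stationary[OF fea_mult[of k] sym(1)]
      by (simp add: eq_neg_iff_add_eq_0 add.commute)
    moreover have "(\<lambda>i. - (Bf (\<phi> i) *v df (\<phi> i))) \<longlonglongrightarrow> - 0"
      by (intro tendsto_minus psd_matrix_vector_tendsto_0[OF psd(1) _ df]) (use A3(3) in blast)
    ultimately have b: "(\<lambda>i. mult_size (\<mu>b (\<phi> i)) (Yb (\<phi> i))) \<longlonglongrightarrow> 0"
      by (intro small[where u = df] df) (use fea_mult in \<open>auto simp: fea_multipliers_def\<close>)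
    have "transpose (Dh h (x k)) *v \<mu>h k + DG_adj G (x k) (Yh k)
      = - (\<rho> k *\<^sub>R gradient f (x k) + B k *v d k)" for k
      using qp_mult[of k] by (simp add: qp_multipliers_def eq_neg_iff_add_eq_0 algebra_simps)
    moreover have "(\<lambda>i. - (\<rho> (\<phi> i) *\<^sub>R gradient f (x (\<phi> i)) + B (\<phi> i) *v d (\<phi> i))) \<longlonglongrightarrow> - (0 + 0)"
      by (intro tendsto_minus tendsto_add rho_grad psd_matrix_vector_tendsto_0[OF psd(2) _ d])
        (use A3(4) in blast)
    ultimately have h: "(\<lambda>i. mult_size (\<mu>h (\<phi> i)) (Yh (\<phi> i))) \<longlonglongrightarrow> 0"
      by (intro small[where u = d] d) (use qp_mult in \<open>auto simp: qp_multipliers_def\<close>)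
    have prod: "(\<lambda>i. \<rho> (\<phi> i) * mult_size (\<mu>b (\<phi> i)) (Yb (\<phi> i))) \<longlonglongrightarrow> 0"
      "(\<lambda>i. \<rho> (\<phi> i) * mult_size (\<mu>h (\<phi> i)) (Yh (\<phi> i))) \<longlonglongrightarrow> 0"
      using tendsto_mult[OF rho b] tendsto_mult[OF rho h] by simp_all
    have "\<forall>\<^sub>F i in sequentially. mult_size (\<mu>b (\<phi> i)) (Yb (\<phi> i)) < 1
      \<and> mult_size (\<mu>h (\<phi> i)) (Yh (\<phi> i)) < 1 - \<epsilon>
      \<and> \<rho> (\<phi> i) * mult_size (\<mu>b (\<phi> i)) (Yb (\<phi> i)) < 1
      \<and> \<rho> (\<phi> i) * mult_size (\<mu>h (\<phi> i)) (Yh (\<phi> i)) < 1"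
      by (intro eventually_conj order_tendstoD(2)[OF b] order_tendstoD(2)[OF h]
          order_tendstoD(2)[OF prod(1)] order_tendstoD(2)[OF prod(2)])
        (use \<open>\<epsilon> < 1\<close> in simp_all)
    then obtain i where i: "mult_size (\<mu>b (\<phi> i)) (Yb (\<phi> i)) < 1"
      "mult_size (\<mu>h (\<phi> i)) (Yh (\<phi> i)) < 1 - \<epsilon>"
      "\<rho> (\<phi> i) * mult_size (\<mu>b (\<phi> i)) (Yb (\<phi> i)) < 1"
      "\<rho> (\<phi> i) * mult_size (\<mu>h (\<phi> i)) (Yh (\<phi> i)) < 1"
      using eventually_happens by force
    define k where "k = \<phi> i"
    have slack: "r k = 0" "s k = 0" "t k = 0"
      using fea_multipliers_small_imp_zero_slack[OF fea_mult _ nonneg] i(1) by (auto simp: k_def)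
    have "qp_constr h G (x k) 0 0 0 (d k)"
      using qp[of k] slack by (simp add: is_arg_min_def)
    moreover have "qp_multipliers f h G (\<rho> k) (x k) (B k) 0 (d k) (\<mu>h k) (Yh k)"
      using qp_mult[of k] slack by simp
    ultimately have "\<rho> (Suc k) = \<rho> k"
      unfolding rho_Suc
      by (rule rho_next_eq_if_small_multipliers) (use psd G_sym i in \<open>auto simp: k_def\<close>)
    with updated[of i] show False by (simp add: k_def)
  qed
  then obtain \<mu> Y where singular: "singular_multipliers h G xs \<mu> Y" by blast
  show ?thesis
    using singular_multipliers_imp_FJ_point[OF singular feasible]
      singular_multipliers_imp_not_robinson_CQ[OF singular] by blast
qed

end
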